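(* Let $M_i,H_i\ge0$ with $M_i+H_i>0$ and $0\le\nu_i\le1$ for $1\le i\le n$. Suppose that for every $1\le i\le n$ the operator $Q_i$ is monotone and $M_i$-Lipschitz on $\mathcal Z$ with respect to $\|\cdot\|_{\mathbf P}$, and $p_i$ is convex and satisfies the $(\nu_i,H_i)$-Hölder condition on $\mathcal Z$ with respect to $\|\cdot\|_{\mathbf P}$. Let $T_1,\dots,T_n$ be positive integers and set $$\Omega_{z_{\mathrm{in}}}:=\sup_{z\in\mathcal Z}\|z_{\mathrm{in}}-z\|_{\mathbf P}^2<\infty,\qquad N_i:=\prod_{j=1}^iT_j.$$ For $0\le\nu_i<1$ put $$K_i=\left[\frac{1-\nu_i}{2(1+\nu_i)}\right]^{\frac{1-\nu_i}{1+\nu_i}}H_i^{\frac2{1+\nu_i}},\qquad\delta_i^\circ=\left[\frac{(1-\nu_i)2^{2i-1}K_i\Omega_{z_{\mathrm{in}}}}{(1+\nu_i)N_i^3}\right]^{(1+\nu_i)/2},\qquad L_i(\delta)=\left[\frac{1-\nu_i}{2(1+\nu_i)}\cdot\frac1\delta\right]^{\frac{1-\nu_i}{1+\nu_i}}H_i^{\frac2{1+\nu_i}},$$ with $L_i(\delta_i^\circ):=0$ if $\delta_i^\circ=0$; for $\nu_i=1$ put $K_i=H_i$, $\delta_i^\circ=0$, $L_i(\delta_i^\circ)=H_i$. Run the Sliding Algorithm (described in the context) from $z_{\mathrm{in}}\in\mathcal Z$, with exact values and exact (sub)gradients $\tilde\nabla p_i=p_i'$ as oracle outputs, with $\alpha_0=1$,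 $\alpha_{t+1}=2/(1+\sqrt{1+4/\alpha_t^2})$, and $$\eta^k_{\mathbf t}=L_k(\delta_k^\circ)\prod_{\ell=1}^k\alpha_{t_\ell}+M_k\prod_{\ell=1}^k\frac{\alpha_{t_\ell}}{\alpha_{T_\ell-1}},\qquad\mathbf t=(t_1,\dots,t_k).$$ Then $$\sup_{z\in\mathcal Z}\left\{p(z_{\mathrm{out}})-p(z)+\langle Q(z),z_{\mathrm{out}}-z\rangle\right\}\le\sum_{i=1}^n\left[\frac{2^{i(1+\nu_i)}H_i\,\Omega_{z_{\mathrm{in}}}^{(1+\nu_i)/2}}{(1+\nu_i)N_i^{(1+3\nu_i)/2}}+\frac{2^{i-1}M_i\,\Omega_{z_{\mathrm{in}}}}{N_i}\right].$$
   Context: Setting. $\mathcal Z\subseteq\mathbb R^{d_z}$ is nonempty, closed and convex; $p=\sum_{i=1}^np_i$ and $Q=\sum_{i=1}^nQ_i$, where each $p_i:\mathcal Z\to\mathbb R$ is convex and each $Q_i:\mathcal Z\to\mathbb R^{d_z}$ is continuous and monotone. $\mathbf P$ is a symmetric positive definite matrix, $\|z\|_{\mathbf P}=\langle\mathbf Pz,z\rangle^{1/2}$ and $\|s\|_{\mathbf P^{-1}}=\langle\mathbf P^{-1}s,s\rangle^{1/2}$. An operator $G$ is monotone if $\langle G(u)-G(v),u-v\rangle\ge0$, and $M$-Lipschitz with respect to $\|\cdot\|_{\mathbf P}$ if $\|G(u)-G(v)\|_{\mathbf P^{-1}}\le M\|u-v\|_{\mathbf P}$, for all $u,v\in\mathcal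 Z$. $h'(u)$ denotes an arbitrary element of the subdifferential $\partial h(u)$, assumed nonempty at every point of $\mathcal Z$. A function $h$ satisfies the $(\nu,H)$-Hölder condition on $\mathcal Z$ with respect to $\|\cdot\|_{\mathbf P}$ if $\|h'(u)-h'(v)\|_{\mathbf P^{-1}}\le H\|u-v\|_{\mathbf P}^\nu$ for all $u,v\in\mathcal Z$ and all $h'(u)\in\partial h(u)$, $h'(v)\in\partial h(v)$ (for $\nu=0$ the right-hand side is $H$). Sliding Algorithm. Data: the pairs $(p_i,Q_i)$, $1\le i\le n$, with oracle vectors $\tilde\nabla p_i(\cdot)$; positive integers $T_1,\dots,T_n$; a sequence $(\alpha_t)_{t\ge0}$; step sizes $\eta^k_{\mathbf t}$ for $1\le k\le n$, $\mathbf t=(t_1,\dots,t_k)$, $0\le t_\ell\le T_\ell-1$; input $z_{\mathrm{in}}\in\mathcal Z$. Set $z^k_{(0,\dots,0)}=z_{\mathrm{in}}$ ($k$ zeros) for $k=1,\dots,n$. The output is $z_{\mathrm{out}}=\mathrm{Rec}(0,\varnothing)$, where for $0\le k\le n$ and $\mathbf t=(t_1,\dots,t_k)$ the procedure $\mathrm{Rec}(k,\mathbf t)$ is: (a) If $k=n$, return $\operatorname{argmin}_{z\in\mathcal Z}\sum_{i=1}^n\big\{\langle\tilde\nabla p_i(w^i_{(t_1,\dots,t_i)})+Q_i(z^i_{(t_1,\dots,t_i)}),z\rangle+\tfrac12\eta^i_{(t_1,\dots,t_i)}\|z-z^i_{(t_1,\dots,t_i)}\|_{\mathbf P}^2\big\}$.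 (b) If $k<n$, set $\bar z^{k+1}_{(\mathbf t,0)}=z^{k+1}_{(\mathbf t,0)}$. For $j=0,\dots,T_{k+1}-1$, with $\mathbf t'=(\mathbf t,j)$ and $\mathbf t''=(\mathbf t,j+1)$: set $\tilde z^{k+1}_{\mathbf t'}=\mathrm{Rec}(k+1,\mathbf t')$; $\bar z^{k+1}_{\mathbf t''}=\alpha_j\tilde z^{k+1}_{\mathbf t'}+(1-\alpha_j)\bar z^{k+1}_{\mathbf t'}$; $z^{k+1}_{\mathbf t''}=\operatorname{argmin}_{z\in\mathcal Z}\{\langle Q_{k+1}(\tilde z^{k+1}_{\mathbf t'})-Q_{k+1}(z^{k+1}_{\mathbf t'}),z\rangle+\tfrac12\eta^{k+1}_{\mathbf t'}\|z-\tilde z^{k+1}_{\mathbf t'}\|_{\mathbf P}^2\}$; and, for $\ell=k+2,\dots,n$, $z^\ell_{(\mathbf t'',0,\dots,0)}=z^\ell_{(\mathbf t',T_{k+2},0,\dots,0)}$ (padding by zeros to length $\ell$). Return $\bar z^{k+1}_{(\mathbf t,T_{k+1})}$. Here $w^i_{(t_1,\dots,t_i)}=(a_1\circ a_2\circ\cdots\circ a_i)(z^i_{(t_1,\dots,t_i)})$ with $a_\ell(z)=\alpha_{t_\ell}z+(1-\alpha_{t_\ell})\bar z^\ell_{(t_1,\dots,t_\ell)}$; the vectors $\tilde\nabla p_i(w^i_{\mathbf t})$ and $Q_i(z^i_{\mathbf t})$ are computed once per multi-index $\mathbf t$ of length $i$. *)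

theory Defs
  imports "HOL-Analysis.Analysis"
begin

definition sym_pos_def :: "real^'d^'d \<Rightarrow> bool" where
  "sym_pos_def P \<longleftrightarrow> transpose P = P \<and> (\<forall>x. x \<noteq> 0 \<longrightarrow> (P *v x) \<bullet> x > 0)"

definition mnorm :: "real^'d^'d \<Rightarrow> real^'d \<Rightarrow> real" where
  "mnorm P z = sqrt ((P *v z) \<bullet> z)"

definition mnorm_dual :: "real^'d^'d \<Rightarrow> real^'d \<Rightarrow> real" where
  "mnorm_dual P s = sqrt ((matrix_inv P *v s) \<bullet> s)"

definition monotone_operator :: "(real^'d) set \<Rightarrow> (real^'d \<Rightarrow> real^'d) \<Rightarrow> bool" where
  "monotone_operator Z G \<longleftrightarrow> (\<forall>u\<in>Z. \<forall>v\<in>Z. (G u - G v) \<bullet> (u - v) \<ge> 0)"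

definition lipschitz_operator ::
  "real^'d^'d \<Rightarrow> (real^'d) set \<Rightarrow> real \<Rightarrow> (real^'d \<Rightarrow> real^'d) \<Rightarrow> bool" where
  "lipschitz_operator P Z M G \<longleftrightarrow>
     (\<forall>u\<in>Z. \<forall>v\<in>Z. mnorm_dual P (G u - G v) \<le> M * mnorm P (u - v))"

text \<open>
  The subdifferential at \<open>u\<close> of a real-valued convex function with domain \<open>X\<close>, i.e. of its
  extension by infinity outside \<open>X\<close>. The domain matters: it adds the normal cone of \<open>X\<close> at \<open>u\<close>.
  If \<open>X\<close> is a nonempty compact convex set, that cone is nonzero at some point, so the
  subdifferential there is empty or unbounded and the Hoelder condition below cannot hold
  together with its nonemptiness on \<open>X\<close>. The domain is therefore kept separate from the
  feasible set \<open>Z\<close>.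
\<close>

definition subdifferential :: "(real^'d) set \<Rightarrow> (real^'d \<Rightarrow> real) \<Rightarrow> real^'d \<Rightarrow> (real^'d) set" where
  "subdifferential X h u = {s. \<forall>v\<in>X. h v \<ge> h u + s \<bullet> (v - u)}"

text \<open>
  The case \<open>\<nu> = 0\<close> is separate because \<open>0 powr 0 = 0\<close>, whereas the right-hand side is meant to be
  \<open>H\<close> even for \<open>u = v\<close>.
\<close>

definition holder_condition ::
  "real^'d^'d \<Rightarrow> (real^'d) set \<Rightarrow> (real^'d) set \<Rightarrow> real \<Rightarrow> real \<Rightarrow> (real^'d \<Rightarrow> real) \<Rightarrow> bool" where
  "holder_condition P X Z \<nu> H h \<longleftrightarrow>
     (\<forall>u\<in>Z. \<forall>v\<in>Z. \<forall>s\<in>subdifferential X h u. \<forall>r\<in>subdifferential X h v.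
        mnorm_dual P (s - r) \<le> (if \<nu> = 0 then H else H * mnorm P (u - v) powr \<nu>))"

text \<open>
  A multi-index \<open>(t\<^sub>1, \<dots>, t\<^sub>k)\<close> is a list of length \<open>k\<close>, with \<open>t\<^sub>l\<close> at position \<open>l - 1\<close>.
  The level \<open>k\<close> of any quantity indexed by a multi-index is the length of that list.
\<close>

definition multi_indices :: "(nat \<Rightarrow> nat) \<Rightarrow> nat \<Rightarrow> nat list set" where
  "multi_indices T k = {t. length t = k \<and> (\<forall>l<k. t ! l < T (Suc l))}"

definition query_point ::
  "(nat \<Rightarrow> real) \<Rightarrow> (nat list \<Rightarrow> real^'d) \<Rightarrow> (nat list \<Rightarrow> real^'d) \<Rightarrow> nat list \<Rightarrow> real^'d" where
  "query_point \<alpha> z zbar t =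
     foldr (\<lambda>l y. \<alpha> (t ! l) *\<^sub>R y + (1 - \<alpha> (t ! l)) *\<^sub>R zbar (take (Suc l) t)) [0..<length t] (z t)"

text \<open>
  A run of the algorithm. Every variable \<open>z\<close>, \<open>zbar\<close>, \<open>ztil\<close> is assigned exactly once, so a run is
  described by the values of these variables together with the oracle vectors \<open>g t\<close> (the one for
  \<open>p\<^sub>i\<close> at \<open>w\<^sub>t\<close>, where \<open>i = length t\<close>) and the values \<open>Rec t\<close> returned by the procedure called at
  level \<open>length t\<close>. The output is \<open>Rec []\<close>.
\<close>

definition sliding_run ::
  "real^'d^'d \<Rightarrow> (real^'d) set \<Rightarrow> nat \<Rightarrow> (nat \<Rightarrow> real^'d \<Rightarrow> real^'d) \<Rightarrow> (nat \<Rightarrow> nat) \<Rightarrow>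
   (nat \<Rightarrow> real) \<Rightarrow> (nat list \<Rightarrow> real) \<Rightarrow> real^'d \<Rightarrow>
   (nat list \<Rightarrow> real^'d) \<Rightarrow> (nat list \<Rightarrow> real^'d) \<Rightarrow> (nat list \<Rightarrow> real^'d) \<Rightarrow>
   (nat list \<Rightarrow> real^'d) \<Rightarrow> (nat list \<Rightarrow> real^'d) \<Rightarrow> bool" where
  "sliding_run P Z n Q T \<alpha> \<eta> zin g z zbar ztil Rec \<longleftrightarrow>
     (\<forall>k\<in>{1..n}. z (replicate k 0) = zin) \<and>
     (\<forall>t\<in>multi_indices T n.
        is_arg_min
          (\<lambda>x. \<Sum>i = 1..n. (g (take i t) + Q i (z (take i t))) \<bullet> x
                 + 1/2 * \<eta> (take i t) * (mnorm P (x - z (take i t)))\<^sup>2)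
          (\<lambda>x. x \<in> Z) (Rec t)) \<and>
     (\<forall>k<n. \<forall>t\<in>multi_indices T k.
        zbar (t @ [0]) = z (t @ [0]) \<and>
        (\<forall>j<T (k+1).
           let t' = t @ [j]; t'' = t @ [j+1] in
             ztil t' = Rec t' \<and>
             zbar t'' = \<alpha> j *\<^sub>R ztil t' + (1 - \<alpha> j) *\<^sub>R zbar t' \<and>
             is_arg_min
               (\<lambda>x. (Q (k+1) (ztil t') - Q (k+1) (z t')) \<bullet> x
                      + 1/2 * \<eta> t' * (mnorm P (x - ztil t'))\<^sup>2)
               (\<lambda>x. x \<in> Z) (z t'') \<and>
             (\<forall>l\<in>{k+2..n}. z (t'' @ replicate (l - (k+1)) 0)
                = z (t' @ [T (k+2)] @ replicate (l - (k+2)) 0))) \<and>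
        Rec t = zbar (t @ [T (k+1)]))"

fun sliding_alpha :: "nat \<Rightarrow> real" where
  "sliding_alpha 0 = 1"
| "sliding_alpha (Suc t) = 2 / (1 + sqrt (1 + 4 / (sliding_alpha t)\<^sup>2))"

definition Omega :: "real^'d^'d \<Rightarrow> (real^'d) set \<Rightarrow> real^'d \<Rightarrow> real" where
  "Omega P Z zin = (SUP z\<in>Z. (mnorm P (zin - z))\<^sup>2)"

definition N_prod :: "(nat \<Rightarrow> nat) \<Rightarrow> nat \<Rightarrow> real" where
  "N_prod T i = (\<Prod>j = 1..i. real (T j))"

definition K_const :: "real \<Rightarrow> real \<Rightarrow> real" where
  "K_const \<nu> H =
     (if \<nu> < 1 then ((1 - \<nu>) / (2 * (1 + \<nu>))) powr ((1 - \<nu>) / (1 + \<nu>)) * H powr (2 / (1 + \<nu>))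
      else H)"

definition delta_opt :: "real \<Rightarrow> real \<Rightarrow> real \<Rightarrow> nat \<Rightarrow> real \<Rightarrow> real" where
  "delta_opt \<nu> H \<Omega> i N =
     (if \<nu> < 1
      then ((1 - \<nu>) * 2 ^ (2 * i - 1) * K_const \<nu> H * \<Omega> / ((1 + \<nu>) * N ^ 3)) powr ((1 + \<nu>) / 2)
      else 0)"

definition L_const :: "real \<Rightarrow> real \<Rightarrow> real \<Rightarrow> real" where
  "L_const \<nu> H \<delta> =
     (if \<nu> < 1
      then if \<delta> = 0 then 0
           else ((1 - \<nu>) / (2 * (1 + \<nu>)) * (1 / \<delta>)) powr ((1 - \<nu>) / (1 + \<nu>)) * H powr (2 / (1 + \<nu>))
      else H)"

definition sliding_step ::
  "(nat \<Rightarrow> real) \<Rightarrow> (nat \<Rightarrow> real) \<Rightarrow> (nat \<Rightarrow> nat) \<Rightarrow> nat list \<Rightarrow> real" where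
  "sliding_step L M T t =
     L (length t) * (\<Prod>l<length t. sliding_alpha (t ! l))
     + M (length t) * (\<Prod>l<length t. sliding_alpha (t ! l) / sliding_alpha (T (Suc l) - 1))"

end

theory Submission
  imports Defs
begin

text \<open>
  The run is a nest of \<open>n\<close> accelerated mirror-prox loops, and the proof follows one quantity through
  all of them. Fix a comparison point \<open>u\<close>. At a multi-index \<open>t\<close> of length \<open>k\<close>, the averages taken by the
  enclosing \<open>k\<close> loops act on a point \<open>x\<close> through an affine map of slope
  \<open>\<alpha>\<^bsub>t1\<^esub> \<cdots> \<alpha>\<^bsub>tk\<^esub>\<close>, called \<open>embed t\<close> below; its slope is \<open>scale t\<close>. The inner loops then
  work with the rescaled functions \<open>x \<mapsto> p\<^sub>i (embed t x) / scale t\<close>. For \<open>i = k\<close> the oracle vector is the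
  gradient of this function at \<open>z\<^sub>t\<close>, since \<open>embed t z\<^sub>t\<close> is the query point, and its smoothness constant
  \<open>L\<^sub>i scale t\<close> is the first summand of the step size. The quantity \<open>gap t x u\<close> adds up the linearised and
  regularised terms of the levels \<open>i \<le> k\<close>, whose vectors are known by then, and for the levels
  \<open>i > k\<close> the true error of the rescaled \<open>p\<^sub>i\<close> plus \<open>\<langle>Q\<^sub>i(u), x - u\<rangle>\<close>. At \<open>k = 0\<close> it is the quantity to
  be bounded; at \<open>k = n\<close> it is nonpositive at the returned point, by optimality of the innermost
  proximal step (\<open>prox_three_point\<close>).

  One pass of the loop at level \<open>k + 1\<close> relates the two kinds of summand. For levels \<open>i \<noteq> k + 1\<close>
  convexity suffices (\<open>prox_term_convex\<close>, \<open>merit_term_inner\<close>). At level \<open>k + 1\<close> a descent inequality for \<open>p\<close>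
  is combined with the extragradient argument for \<open>Q\<close> (\<open>extragradient_step\<close>), which absorbs the
  quadratic terms because \<open>\<eta> \<ge> L scale + M\<close>. The result is a recursion with factor \<open>1 - \<alpha>\<^sub>j\<close>
  (\<open>gap_step\<close>). Since \<open>(1 - \<alpha>\<^bsub>j+1\<^esub>) / \<alpha>\<^bsub>j+1\<^esub>\<^sup>2 = 1 / \<alpha>\<^sub>j\<^sup>2\<close>, division by \<open>\<alpha>\<^sub>j\<^sup>2\<close> turns it into a telescoping
  sum: the step sizes are such that the coefficient of the squared distance at each
  level does not depend on \<open>j\<close>, and the warm start joins the end of one inner
  loop to the start of the next. Downward induction on \<open>k\<close> gives \<open>gap_bound\<close>, and \<open>\<alpha>\<^bsub>T-1\<^esub> \<le> 2/T\<close> gives the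
  rates \<open>L\<^sub>i \<Omega> / N\<^sub>i\<^sup>2\<close> and \<open>M\<^sub>i \<Omega> / N\<^sub>i\<close> plus the accumulated error \<open>N\<^sub>i \<delta>\<^sub>i\<close> (\<open>output_gap_bound\<close>).

  What remains concerns one \<open>p\<^sub>i\<close> at a time. The Hoelder condition bounds the linearisation error
  by \<open>H r\<^bsup>1+\<nu>\<^esup> / (1 + \<nu>)\<close> (\<open>holder_upper_bound\<close>). For \<open>\<nu> = 1\<close> this is a descent inequality with \<open>L = H\<close>
  and \<open>\<delta> = 0\<close>. For \<open>\<nu> < 1\<close> it is at most \<open>L(\<delta>) r\<^sup>2 / 2 + \<delta>\<close> for every \<open>\<delta> > 0\<close>, by Young's
  inequality (\<open>powr_le_quadratic_plus_error\<close>). The prescribed \<open>\<delta>\<close> is the minimiser of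
  \<open>2\<^bsup>2i-1\<^esup> L(\<delta>) \<Omega> / N\<^sup>2 + N \<delta>\<close>, and its minimum is the first summand of the claimed bound
  (\<open>optimal_delta_value\<close>).
\<close>

section \<open>The norm of a positive definite matrix and proximal steps\<close>

lemma mnorm_nonneg:
  assumes "sym_pos_def P"
  shows "mnorm P x \<ge> 0"
proof -
  have "(P *v x) \<bullet> x \<ge> 0"
    using assms unfolding sym_pos_def_def by (cases "x = 0") (auto intro: less_imp_le)
  then show ?thesis by (simp add: mnorm_def)
qed

lemma mnorm_power2:
  assumes "sym_pos_def P"
  shows "(mnorm P x)\<^sup>2 = (P *v x) \<bullet> x"
proof -
  have "(P *v x) \<bullet> x \<ge> 0"
    using assms unfolding sym_pos_def_def by (cases "x = 0") (auto intro: less_imp_le)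
  then show ?thesis by (simp add: mnorm_def)
qed

lemma mnorm_pos:
  assumes "sym_pos_def P" "x \<noteq> 0"
  shows "mnorm P x > 0"
  using assms by (simp add: mnorm_def sym_pos_def_def)

lemma mnorm_zero [simp]: "mnorm P 0 = 0"
  by (simp add: mnorm_def)

lemma mnorm_scaleR: "mnorm P (c *\<^sub>R x) = \<bar>c\<bar> * mnorm P x"
proof -
  have "(P *v (c *\<^sub>R x)) \<bullet> (c *\<^sub>R x) = c\<^sup>2 * ((P *v x) \<bullet> x)"
    by (simp add: matrix_vector_mult_scaleR power2_eq_square)
  then show ?thesis
    by (simp add: mnorm_def real_sqrt_mult)
qed

lemma mnorm_minus_commute: "mnorm P (x - y) = mnorm P (y - x)"
  using mnorm_scaleR[of P "-1" "x - y"] by simp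

lemma sym_pos_def_commute:
  assumes "sym_pos_def P"
  shows "(P *v x) \<bullet> y = (P *v y) \<bullet> x"
proof -
  have "transpose P = P" using assms by (simp add: sym_pos_def_def)
  then have "(P *v x) \<bullet> y = x \<bullet> (P *v y)"
    by (metis dot_lmul_matrix vector_transpose_matrix)
  then show ?thesis by (simp add: inner_commute)
qed

lemma mnorm_power2_convex_combination:
  assumes "sym_pos_def P"
  shows "(mnorm P ((1 - \<tau>) *\<^sub>R x + \<tau> *\<^sub>R y))\<^sup>2
    = (1 - \<tau>) * (mnorm P x)\<^sup>2 + \<tau> * (mnorm P y)\<^sup>2 - \<tau> * (1 - \<tau>) * (mnorm P (x - y))\<^sup>2"
  unfolding mnorm_power2[OF assms] using sym_pos_def_commute[OF assms, of x y]
  by (simp add: matrix_vector_mult_scaleR matrix_vector_right_distrib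
      matrix_vector_mult_diff_distrib inner_simps algebra_simps power2_eq_square)

lemma mnorm_power2_convex:
  assumes "sym_pos_def P" "0 \<le> \<tau>" "\<tau> \<le> 1"
  shows "(mnorm P (\<tau> *\<^sub>R x + (1 - \<tau>) *\<^sub>R y))\<^sup>2 \<le> \<tau> * (mnorm P x)\<^sup>2 + (1 - \<tau>) * (mnorm P y)\<^sup>2"
proof -
  have "\<tau> * (1 - \<tau>) * (mnorm P (y - x))\<^sup>2 \<ge> 0"
    using assms(2,3) by simp
  then show ?thesis
    using mnorm_power2_convex_combination[OF assms(1), of \<tau> y x] by (simp add: add.commute)
qed

lemma mnorm_Cauchy_Schwarz:
  assumes "sym_pos_def P"
  shows "(P *v x) \<bullet> y \<le> mnorm P x * mnorm P y"
proof (cases "mnorm P y = 0")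
  case True
  then have "y = 0" using mnorm_pos[OF assms, of y] by fastforce
  then show ?thesis by simp
next
  case False
  define b where "b = (mnorm P y)\<^sup>2"
  define c where "c = (P *v x) \<bullet> y"
  have b: "b > 0" using False by (simp add: b_def)
  \<comment> \<open>The discriminant argument: the form is nonnegative at this combination.\<close>
  have "0 \<le> (mnorm P (b *\<^sub>R x - c *\<^sub>R y))\<^sup>2" by simp
  also have "\<dots> = b * (b * (mnorm P x)\<^sup>2 - c\<^sup>2)"
    unfolding b_def c_def mnorm_power2[OF assms] using sym_pos_def_commute[OF assms, of x y]
    by (simp add: matrix_vector_mult_scaleR
        matrix_vector_mult_diff_distrib inner_simps algebra_simps power2_eq_square)
  finally have "c\<^sup>2 \<le> b * (mnorm P x)\<^sup>2"
    using b by (simp add: zero_le_mult_iff)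
  then have "c\<^sup>2 \<le> (mnorm P x * mnorm P y)\<^sup>2"
    by (simp add: b_def power_mult_distrib mult.commute)
  then show ?thesis
    unfolding c_def[symmetric]
    by (rule power2_le_imp_le) (simp add: mnorm_nonneg[OF assms])
qed

lemma sym_pos_def_invertible:
  assumes "sym_pos_def P"
  shows "invertible P"
proof -
  have "\<forall>x. P *v x = 0 \<longrightarrow> x = 0"
    using assms unfolding sym_pos_def_def by (metis inner_zero_left less_irrefl)
  then show ?thesis
    using invertible_left_inverse matrix_left_invertible_ker by blast
qed

text \<open>
  The dual pairing reduces to the Cauchy-Schwarz inequality of the form \<open>\<langle>P y, x\<rangle>\<close> by writing
  \<open>s = P y\<close>; then the dual norm of \<open>s\<close> is the norm of \<open>y\<close>.
\<close>

lemma inner_le_mnorm_dual: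
  assumes "sym_pos_def P"
  shows "s \<bullet> x \<le> mnorm_dual P s * mnorm P x"
proof -
  define y where "y = matrix_inv P *v s"
  have "P ** matrix_inv P = mat 1"
    using sym_pos_def_invertible[OF assms] unfolding invertible_def matrix_inv_def
    by (rule someI2_ex) simp
  then have s: "P *v y = s"
    by (simp add: y_def matrix_vector_mul_assoc)
  have "s \<bullet> x \<le> mnorm P y * mnorm P x"
    using mnorm_Cauchy_Schwarz[OF assms, of y x] s by simp
  also have "mnorm P y = mnorm_dual P s"
    unfolding mnorm_def mnorm_dual_def s by (simp add: y_def inner_commute)
  finally show ?thesis .
qed

lemma nonpos_if_le_small_multiples:
  fixes a b :: real
  assumes "\<And>\<tau>. 0 < \<tau> \<Longrightarrow> \<tau> \<le> 1 \<Longrightarrow> a \<le> \<tau> * b"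
  shows "a \<le> 0"
proof (rule ccontr)
  assume "\<not> a \<le> 0"
  then have a: "a > 0" by simp
  have b: "a \<le> b" using assms[of 1] by simp
  have "a \<le> a / (2 * b) * b"
    using a b by (intro assms) auto
  also have "\<dots> = a / 2" using a b by simp
  finally show False using a by simp
qed

text \<open>
  Optimality of a proximal step in its usual three-point form. Along the segment from the minimiser
  \<open>x\<close> to \<open>u\<close> the objective is a quadratic of curvature \<open>\<Sum>\<eta> \<parallel>u - x\<parallel>\<^sup>2\<close>, so minimality near the
  endpoint \<open>x\<close> yields the extra term \<open>\<parallel>u - x\<parallel>\<^sup>2\<close> with no derivative being taken. Sums of several
  prox terms are needed because the innermost step carries one for every level.
\<close>

lemma prox_three_point:
  fixes P :: "real^'d^'d" and I :: "'i set"
  assumes P: "sym_pos_def P" and Z: "convex Z"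
    and min: "is_arg_min (\<lambda>x. \<Sum>i\<in>I. G i \<bullet> x + 1/2 * \<eta> i * (mnorm P (x - y i))\<^sup>2) (\<lambda>x. x \<in> Z) x"
    and u: "u \<in> Z"
  shows "(\<Sum>i\<in>I. G i \<bullet> (x - u))
    \<le> (\<Sum>i\<in>I. \<eta> i / 2 * ((mnorm P (u - y i))\<^sup>2 - (mnorm P (x - y i))\<^sup>2 - (mnorm P (u - x))\<^sup>2))"
proof -
  define f where "f = (\<lambda>i x. G i \<bullet> x + 1/2 * \<eta> i * (mnorm P (x - y i))\<^sup>2)"
  define D where "D = (\<Sum>i\<in>I. \<eta> i / 2 * (mnorm P (u - x))\<^sup>2)"
  have x: "x \<in> Z" and xmin: "(\<Sum>i\<in>I. f i x) \<le> (\<Sum>i\<in>I. f i v)" if "v \<in> Z" for v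
    using min that unfolding is_arg_min_def f_def by (auto simp: not_less)
  have "(\<Sum>i\<in>I. f i x) - (\<Sum>i\<in>I. f i u) + D \<le> \<tau> * D" if \<tau>: "0 < \<tau>" "\<tau> \<le> 1" for \<tau>
  proof -
    define v where "v = (1 - \<tau>) *\<^sub>R x + \<tau> *\<^sub>R u"
    have "f i v = (1 - \<tau>) * f i x + \<tau> * f i u - \<tau> * (1 - \<tau>) * (\<eta> i / 2 * (mnorm P (u - x))\<^sup>2)" for i
    proof -
      have "v - y i = (1 - \<tau>) *\<^sub>R (x - y i) + \<tau> *\<^sub>R (u - y i)"
        by (simp add: v_def algebra_simps)
      then have "(mnorm P (v - y i))\<^sup>2 = (1 - \<tau>) * (mnorm P (x - y i))\<^sup>2
          + \<tau> * (mnorm P (u - y i))\<^sup>2 - \<tau> * (1 - \<tau>) * (mnorm P (u - x))\<^sup>2"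
        using mnorm_power2_convex_combination[OF P, of \<tau> "x - y i" "u - y i"]
        by (simp add: mnorm_minus_commute)
      then show ?thesis
        unfolding f_def by (simp only:) (simp add: v_def inner_simps field_simps)
    qed
    then have "(\<Sum>i\<in>I. f i v)
        = (1 - \<tau>) * (\<Sum>i\<in>I. f i x) + \<tau> * (\<Sum>i\<in>I. f i u) - \<tau> * (1 - \<tau>) * D"
      by (simp add: D_def sum.distrib sum_subtractf sum_distrib_left)
    moreover have "v \<in> Z"
      unfolding v_def using Z u x[OF u] \<tau> by (intro convexD) auto
    ultimately have "\<tau> * ((\<Sum>i\<in>I. f i x) - (\<Sum>i\<in>I. f i u) + D) \<le> \<tau> * (\<tau> * D)"
      using xmin[of v] by (simp add: algebra_simps)
    then show ?thesis using \<tau> by simp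
  qed
  then have "(\<Sum>i\<in>I. f i x) - (\<Sum>i\<in>I. f i u) + D \<le> 0"
    by (rule nonpos_if_le_small_multiples)
  then have "(\<Sum>i\<in>I. f i x - f i u + \<eta> i / 2 * (mnorm P (u - x))\<^sup>2) \<le> 0"
    by (simp add: D_def sum.distrib sum_subtractf)
  also have "(\<Sum>i\<in>I. f i x - f i u + \<eta> i / 2 * (mnorm P (u - x))\<^sup>2) =
     (\<Sum>i\<in>I. G i \<bullet> (x - u)) -
     (\<Sum>i\<in>I. \<eta> i / 2 * ((mnorm P (u - y i))\<^sup>2 - (mnorm P (x - y i))\<^sup>2 - (mnorm P (u - x))\<^sup>2))"
    unfolding sum_subtractf[symmetric]
    by (intro sum.cong) (auto simp: f_def inner_simps algebra_simps)
  finally show ?thesis by simp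
qed

section \<open>The averaging weights\<close>

lemma sliding_alpha_pos: "sliding_alpha t > 0"
proof (induction t)
  case (Suc t)
  have "1 + sqrt (1 + 4 / (sliding_alpha t)\<^sup>2) > 0"
    by (intro add_pos_nonneg) auto
  then show ?case by simp
qed simp

lemma inverse_sliding_alpha_step: "1 / sliding_alpha t + 1 / 2 \<le> 1 / sliding_alpha (Suc t)"
proof -
  have "2 / sliding_alpha t = sqrt ((2 / sliding_alpha t)\<^sup>2)"
    using sliding_alpha_pos[of t] by simp
  also have "\<dots> \<le> sqrt (1 + 4 / (sliding_alpha t)\<^sup>2)"
    by (intro real_sqrt_le_mono) (simp add: power_divide)
  finally show ?thesis by simp
qed

text \<open>
  The recursion for \<open>\<alpha>\<close> is the solution formula of this quadratic equation for \<open>1/\<alpha>\<^bsub>t+1\<^esub>\<close>. The equation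
  makes a recursion with factors \<open>1 - \<alpha>\<^sub>t\<close> telescope under the weights \<open>1/\<alpha>\<^sub>t\<^sup>2\<close>.
\<close>

lemma sliding_alpha_recurrence:
  "(1 - sliding_alpha (Suc t)) / (sliding_alpha (Suc t))\<^sup>2 = 1 / (sliding_alpha t)\<^sup>2"
proof -
  define s where "s = sqrt (1 + 4 / (sliding_alpha t)\<^sup>2)"
  have s: "s\<^sup>2 = 1 + 4 / (sliding_alpha t)\<^sup>2" "s \<ge> 0"
    by (simp_all add: s_def)
  have "sliding_alpha (Suc t) = 2 / (1 + s)" by (simp add: s_def)
  moreover have "(1 - 2 / (1 + s)) / (2 / (1 + s))\<^sup>2 = (s\<^sup>2 - 1) / 4"
    using s(2) by (simp add: field_simps power2_eq_square)
  ultimately show ?thesis using s by simp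
qed

lemma sliding_alpha_Suc_le: "sliding_alpha (Suc t) \<le> sliding_alpha t"
proof -
  have "1 / sliding_alpha t \<le> 1 / sliding_alpha (Suc t)"
    using inverse_sliding_alpha_step[of t] by simp
  then show ?thesis
    using sliding_alpha_pos[of t] sliding_alpha_pos[of "Suc t"] by (simp add: divide_simps del: sliding_alpha.simps split: if_splits)
qed

lemma sliding_alpha_antimono: "s \<le> t \<Longrightarrow> sliding_alpha t \<le> sliding_alpha s"
  by (rule lift_Suc_antimono_le[of sliding_alpha]) (rule sliding_alpha_Suc_le)

lemma sliding_alpha_le_1: "sliding_alpha t \<le> 1"
  using sliding_alpha_antimono[of 0 t] by simp

lemma sliding_alpha_upper:
  assumes "m \<ge> 1"
  shows "sliding_alpha (m - 1) \<le> 2 / real m"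
proof -
  have "1 + real t / 2 \<le> 1 / sliding_alpha t" for t
  proof (induction t)
    case (Suc t)
    then show ?case using inverse_sliding_alpha_step[of t] by (simp add: add_divide_distrib del: sliding_alpha.simps)
  qed simp
  from this[of "m - 1"] have "real m / 2 \<le> 1 / sliding_alpha (m - 1)"
    using assms by (simp add: of_nat_diff field_simps)
  then show ?thesis
    using assms sliding_alpha_pos[of "m - 1"] by (simp add: field_simps)
qed

text \<open>
  After division by \<open>\<alpha>\<^sub>j\<^sup>2\<close> the factor of \<open>V j\<close> is \<open>1/\<alpha>\<^bsub>j-1\<^esub>\<^sup>2\<close>, by the recurrence above; the
  initial value \<open>V 0\<close> disappears because \<open>\<alpha>\<^sub>0 = 1\<close>.
\<close>

lemma weighted_recursion:
  fixes V b :: "nat \<Rightarrow> real"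
  assumes "m \<ge> 1"
    and step: "\<And>j. j < m \<Longrightarrow> V (Suc j) \<le> (1 - sliding_alpha j) * V j + sliding_alpha j * b j"
  shows "V m \<le> (sliding_alpha (m - 1))\<^sup>2 * (\<Sum>j<m. b j / sliding_alpha j)"
proof -
  have "V (Suc j) / (sliding_alpha j)\<^sup>2 \<le> (\<Sum>i<Suc j. b i / sliding_alpha i)" if "j < m" for j
    using that
  proof (induction j)
    case 0
    then show ?case using step[of 0] by simp
  next
    case (Suc j)
    define a where "a = sliding_alpha (Suc j)"
    have a: "a > 0" unfolding a_def by (rule sliding_alpha_pos)
    have "V (Suc (Suc j)) / a\<^sup>2 \<le> ((1 - a) * V (Suc j) + a * b (Suc j)) / a\<^sup>2"
      using step[OF Suc.prems] unfolding a_def by (intro divide_right_mono) auto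
    also have "\<dots> = (1 - a) / a\<^sup>2 * V (Suc j) + b (Suc j) / a"
      using a by (simp add: add_divide_distrib power2_eq_square)
    also have "(1 - a) / a\<^sup>2 * V (Suc j) = V (Suc j) / (sliding_alpha j)\<^sup>2"
      unfolding a_def sliding_alpha_recurrence by simp
    also have "\<dots> \<le> (\<Sum>i<Suc j. b i / sliding_alpha i)"
      using Suc by simp
    finally show ?case by (simp add: a_def del: sliding_alpha.simps)
  qed
  from this[of "m - 1"] show ?thesis
    using assms(1) sliding_alpha_pos[of "m - 1"] by (simp add: field_simps)
qed

section \<open>Subgradients satisfying a Hoelder condition\<close>

text \<open>
  Convexity of \<open>x \<mapsto> x\<^bsup>1+\<nu>\<^esup>\<close>. Its sum over the integers below bounds the Riemann sum of \<open>x\<^bsup>\<nu>\<^esup>\<close>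
  used in the next estimate.
\<close>

lemma powr_above_tangent:
  fixes a b \<nu> :: real
  assumes "0 \<le> \<nu>" "0 \<le> a" "a \<le> b"
  shows "(1 + \<nu>) * a powr \<nu> * (b - a) \<le> b powr (1 + \<nu>) - a powr (1 + \<nu>)"
proof (cases "a = 0")
  case False
  then have a: "a > 0" and b: "b > 0" using assms by auto
  have "b = a \<or> (\<exists>x. a < x \<and> x < b \<and> b powr (1 + \<nu>) - a powr (1 + \<nu>) = (b - a) * ((1 + \<nu>) * x powr \<nu>))"
  proof (cases "a = b")
    case False
    have "\<exists>x>a. x < b \<and> b powr (1 + \<nu>) - a powr (1 + \<nu>) = (b - a) * ((1 + \<nu>) * x powr \<nu>)"
      using False assms a
      by (intro MVT2) (auto intro!: derivative_eq_intros)
    then show ?thesis by auto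
  qed simp
  then show ?thesis
  proof
    assume "\<exists>x. a < x \<and> x < b \<and> b powr (1 + \<nu>) - a powr (1 + \<nu>) = (b - a) * ((1 + \<nu>) * x powr \<nu>)"
    then obtain x where x: "a < x" "x < b"
      and eq: "b powr (1 + \<nu>) - a powr (1 + \<nu>) = (b - a) * ((1 + \<nu>) * x powr \<nu>)"
      by blast
    have "a powr \<nu> \<le> x powr \<nu>"
      using x a assms by (intro powr_mono2) auto
    then have "(1 + \<nu>) * a powr \<nu> * (b - a) \<le> (1 + \<nu>) * x powr \<nu> * (b - a)"
      using assms by (intro mult_right_mono mult_left_mono) auto
    then show ?thesis unfolding eq by (simp add: algebra_simps)
  qed simp
qed (use assms in simp)

lemma sum_powr_le:
  fixes \<nu> :: real
  assumes "0 \<le> \<nu>"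
  shows "(1 + \<nu>) * (\<Sum>m<k. real m powr \<nu>) \<le> real k powr (1 + \<nu>)"
proof (induction k)
  case (Suc k)
  have "(1 + \<nu>) * real k powr \<nu> \<le> real (Suc k) powr (1 + \<nu>) - real k powr (1 + \<nu>)"
    using powr_above_tangent[OF assms, of "real k" "real (Suc k)"] by simp
  then show ?case using Suc by (simp add: distrib_left)
qed simp

text \<open>
  Formally this integrates the Hoelder bound for the subgradients along the segment from \<open>w\<close> to \<open>y\<close>.
  To avoid differentiating \<open>h\<close>, the segment is cut into \<open>K\<close> equal pieces and the
  increment on each piece is bounded by a subgradient at its far end. The Riemann sum that arises
  exceeds \<open>1 / (1 + \<nu>)\<close> by at most \<open>1 / K\<close>, and \<open>K\<close> is arbitrary. The sharp constant \<open>1 / (1 + \<nu>)\<close> is what the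
  formula for \<open>L(\<delta>)\<close> relies on.
\<close>

lemma holder_upper_bound:
  fixes P :: "real^'d^'d"
  assumes P: "sym_pos_def P" and Z: "convex Z" "Z \<subseteq> X"
    and sub: "\<And>u. u \<in> Z \<Longrightarrow> subdifferential X h u \<noteq> {}"
    and holder: "holder_condition P X Z \<nu> H h" and \<nu>: "0 \<le> \<nu>" and H: "0 \<le> H"
    and w: "w \<in> Z" and y: "y \<in> Z" and g: "g \<in> subdifferential X h w"
  shows "h y \<le> h w + g \<bullet> (y - w) + H / (1 + \<nu>) * mnorm P (y - w) powr (1 + \<nu>)"
proof (cases "y = w")
  case False
  define r where "r = mnorm P (y - w)"
  have r: "r > 0" unfolding r_def using False P by (simp add: mnorm_pos)
  define C where "C = H * r powr (1 + \<nu>)"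
  have C: "C \<ge> 0" using H by (simp add: C_def)
  have bound: "h y - h w - g \<bullet> (y - w) \<le> C / (1 + \<nu>) + C * (1 / real (Suc N))" for N
  proof -
    define K where "K = Suc N"
    have K: "real K > 0" by (simp add: K_def)
    define x where "x = (\<lambda>m. w + (real m / real K) *\<^sub>R (y - w))"
    have xZ: "x m \<in> Z" if "m \<le> K" for m
    proof -
      have "x m = (1 - real m / real K) *\<^sub>R w + (real m / real K) *\<^sub>R y"
        by (simp add: x_def algebra_simps)
      then show ?thesis
        using that w y Z(1) K by (auto intro!: convexD)
    qed
    have step: "h (x (Suc m)) - h (x m) \<le> g \<bullet> (y - w) / real K
        + C * (real (Suc m) / real K) powr \<nu> / real K" if m: "m < K" for m
    proof -
      obtain s where s: "s \<in> subdifferential X h (x (Suc m))"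
        using sub[OF xZ[of "Suc m"]] m by auto
      have "x m \<in> X" using xZ[of m] m Z(2) by auto
      then have "h (x m) \<ge> h (x (Suc m)) + s \<bullet> (x m - x (Suc m))"
        using s by (simp add: subdifferential_def)
      moreover have "x m - x (Suc m) = - ((1 / real K) *\<^sub>R (y - w))"
        by (simp add: x_def flip: scaleR_diff_left diff_divide_distrib)
      ultimately have "h (x (Suc m)) - h (x m) \<le> s \<bullet> (y - w) / real K"
        by simp
      also have "s \<bullet> (y - w) \<le> g \<bullet> (y - w) + C * (real (Suc m) / real K) powr \<nu>"
      proof -
        define b where "b = real (Suc m) / real K"
        have b: "b > 0" using K by (simp add: b_def)
        have dx: "mnorm P (x (Suc m) - w) = b * r"
          unfolding x_def r_def b_def using K by (simp add: mnorm_scaleR)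
        have "mnorm_dual P (s - g) \<le> (if \<nu> = 0 then H else H * mnorm P (x (Suc m) - w) powr \<nu>)"
          using holder s g w xZ[of "Suc m"] m unfolding holder_condition_def by auto
        \<comment> \<open>The points differ, so the case \<open>\<nu> = 0\<close> agrees with the general formula.\<close>
        also have "\<dots> = H * (b * r) powr \<nu>"
          using b r by (simp add: dx)
        finally have "mnorm_dual P (s - g) * r \<le> H * (b * r) powr \<nu> * r"
          using r by simp
        moreover have "(s - g) \<bullet> (y - w) \<le> mnorm_dual P (s - g) * r"
          unfolding r_def by (rule inner_le_mnorm_dual[OF P])
        moreover have "H * (b * r) powr \<nu> * r = C * b powr \<nu>"
          using b r by (simp add: C_def powr_mult powr_add)
        ultimately show ?thesis by (simp add: inner_diff_left b_def)
      qed
      finally show ?thesis using K by (simp add: divide_right_mono add_divide_distrib)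
    qed
    have "h y - h w = (\<Sum>m<K. h (x (Suc m)) - h (x m))"
      using K by (subst sum_lessThan_telescope) (simp add: x_def)
    also have "\<dots> \<le> (\<Sum>m<K. g \<bullet> (y - w) / real K + C * (real (Suc m) / real K) powr \<nu> / real K)"
      by (intro sum_mono step) simp
    also have "\<dots> = g \<bullet> (y - w) + C / (real K powr \<nu> * real K) * (\<Sum>m<K. real (Suc m) powr \<nu>)"
    proof -
      have "(\<Sum>m<K. C * (real (Suc m) / real K) powr \<nu> / real K)
          = C / (real K powr \<nu> * real K) * (\<Sum>m<K. real (Suc m) powr \<nu>)"
        using K by (simp add: sum_distrib_left powr_divide)
      then show ?thesis using K by (simp add: sum.distrib)
    qed
    also have "\<dots> \<le> g \<bullet> (y - w)
        + C / (real K powr \<nu> * real K) * (real K powr (1 + \<nu>) / (1 + \<nu>) + real K powr \<nu>)"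
    proof -
      have "(\<Sum>m<K. real (Suc m) powr \<nu>) \<le> (\<Sum>m<K. real m powr \<nu>) + real K powr \<nu>"
        using sum.lessThan_Suc[of "\<lambda>m. real m powr \<nu>" K]
          sum.lessThan_Suc_shift[of "\<lambda>m. real m powr \<nu>" K] by simp
      moreover have "(\<Sum>m<K. real m powr \<nu>) \<le> real K powr (1 + \<nu>) / (1 + \<nu>)"
        using sum_powr_le[OF \<nu>, of K] \<nu> by (simp add: field_simps)
      ultimately have "(\<Sum>m<K. real (Suc m) powr \<nu>)
          \<le> real K powr (1 + \<nu>) / (1 + \<nu>) + real K powr \<nu>" by simp
      then show ?thesis
        using C by (intro add_left_mono mult_left_mono) auto
    qed
    finally have "h y - h w - g \<bullet> (y - w)
        \<le> C / (real K powr \<nu> * real K) * (real K powr (1 + \<nu>) / (1 + \<nu>) + real K powr \<nu>)"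
      by simp
    also have "\<dots> = C / (1 + \<nu>) + C * (1 / real K)"
      using K \<nu> by (simp add: powr_add distrib_left)
    finally show ?thesis by (simp add: K_def)
  qed
  \<comment> \<open>Division into \<open>K\<close> pieces costs an excess of \<open>C / K\<close>, which tends to zero.\<close>
  have "(\<lambda>N. C / (1 + \<nu>) + C * (1 / real (Suc N))) \<longlonglongrightarrow> C / (1 + \<nu>) + C * 0"
    by (intro tendsto_intros LIMSEQ_Suc lim_1_over_n)
  then have "h y - h w - g \<bullet> (y - w) \<le> C / (1 + \<nu>) + C * 0"
    by (rule LIMSEQ_le_const) (use bound in auto)
  then show ?thesis by (simp add: C_def r_def)
qed simp

text \<open>
  Young's inequality with weights \<open>(1 + \<nu>) / 2\<close> and \<open>(1 - \<nu>) / 2\<close>; \<open>L(\<delta>)\<close> is the constant for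
  which the geometric mean on its left-hand side equals \<open>H r\<^bsup>1+\<nu>\<^esup> / (1 + \<nu>)\<close>.
\<close>

lemma powr_le_quadratic_plus_error:
  assumes \<nu>: "0 \<le> \<nu>" "\<nu> < 1" and H: "0 < H" and \<delta>: "0 < \<delta>" and r: "0 \<le> r"
  shows "H / (1 + \<nu>) * r powr (1 + \<nu>) \<le> L_const \<nu> H \<delta> / 2 * r\<^sup>2 + \<delta>"
proof (cases "r = 0")
  case False
  then have r: "r > 0" using r by simp
  define \<theta> where "\<theta> = (1 + \<nu>) / 2"
  have \<theta>: "1 - \<theta> = (1 - \<nu>) / 2" "0 < \<theta>" "\<theta> < 1" using \<nu> by (simp_all add: \<theta>_def field_simps)
  define c where "c = (1 - \<nu>) / (2 * (1 + \<nu>)) * (1 / \<delta>)"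
  have c: "c > 0" using \<nu> \<delta> by (simp add: c_def)
  define L where "L = c powr ((1 - \<nu>) / (1 + \<nu>)) * H powr (2 / (1 + \<nu>))"
  have L: "L > 0" using c H by (simp add: L_def)
  have L_eq: "L_const \<nu> H \<delta> = L" using \<nu> \<delta> by (simp add: L_const_def L_def c_def)
  \<comment> \<open>These are the values for which the weighted arithmetic mean is the right-hand side.\<close>
  define A where "A = L * r\<^sup>2 / (1 + \<nu>)"
  define B where "B = 2 * \<delta> / (1 - \<nu>)"
  have "A powr \<theta> * B powr (1 - \<theta>) \<le> \<theta> * A + (1 - \<theta>) * B"
    using \<theta> L r \<nu> \<delta> by (intro Youngs_inequality_0) (auto simp: A_def B_def)
  also have "\<theta> * A = L / 2 * r\<^sup>2" using \<nu> by (simp add: A_def \<theta>_def field_simps)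
  also have "(1 - \<theta>) * B = \<delta>" using \<nu> by (simp add: B_def \<theta>(1))
  also have "A powr \<theta> * B powr (1 - \<theta>) = H / (1 + \<nu>) * r powr (1 + \<nu>)"
  proof -
    have e1: "(1 - \<nu>) / (1 + \<nu>) * \<theta> = 1 - \<theta>" "2 / (1 + \<nu>) * \<theta> = 1"
      unfolding \<theta>(1) using \<nu> by (simp_all add: \<theta>_def)
    have "L powr \<theta> = c powr (1 - \<theta>) * H"
      using c H e1 by (simp add: L_def powr_mult powr_powr \<theta>(1))
    moreover have "(r\<^sup>2) powr \<theta> = r powr (1 + \<nu>)"
      using r by (simp add: \<theta>_def powr_powr add_divide_distrib flip: powr_numeral)
    ultimately have "A powr \<theta> * B powr (1 - \<theta>)
        = (c * B) powr (1 - \<theta>) * H * r powr (1 + \<nu>) / (1 + \<nu>) powr \<theta>"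
      using L r \<nu> c \<delta> by (simp add: A_def B_def powr_mult powr_divide mult_ac)
    also have "c * B = 1 / (1 + \<nu>)"
    proof -
      have "a / (2 * b) * (1 / \<delta>) * (2 * \<delta> / a) = 1 / b" if "a \<noteq> 0" "b \<noteq> 0" for a b :: real
        using that \<delta> by simp
      from this[of "1 - \<nu>" "1 + \<nu>"] show ?thesis using \<nu> by (simp only: c_def B_def)
    qed
    also have "(1 / (1 + \<nu>)) powr (1 - \<theta>) = (1 + \<nu>) powr \<theta> / (1 + \<nu>)"
      using \<nu> by (simp add: powr_divide powr_diff)
    finally show ?thesis using \<nu> by simp
  qed
  finally show ?thesis by (simp add: L_eq)
qed (use \<delta> in simp)

section \<open>The optimal smoothing error\<close>

text \<open>
  With \<open>\<rho> = (1 - \<nu>) / (1 + \<nu>)\<close> one has \<open>L(\<delta>) = K \<delta>\<^bsup>-\<rho>\<^esup>\<close>, so the left-hand side below is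
  \<open>A \<delta>\<^bsup>-\<rho>\<^esup> + N \<delta>\<close> with \<open>A = 2\<^bsup>2i-1\<^esup> K \<Omega> / N\<^sup>2\<close>. It is minimal where \<open>\<rho> A \<delta>\<^bsup>-\<rho>\<^esup> = N \<delta>\<close>, which is
  the prescribed \<open>\<delta>\<close>, and there it equals \<open>(1/\<rho> + 1) N \<delta> = 2 N \<delta> / (1 - \<nu>)\<close>.
\<close>

lemma optimal_delta_value:
  assumes \<nu>: "0 \<le> \<nu>" "\<nu> < 1" and H: "0 < H" and \<Omega>: "0 < \<Omega>" and N: "0 < N" and i: "i \<ge> 1"
  defines "\<delta> \<equiv> delta_opt \<nu> H \<Omega> i N"
  shows "0 < \<delta>"
    and "2 ^ (2 * i - 1) * L_const \<nu> H \<delta> * \<Omega> / N\<^sup>2 + N * \<delta>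
      = 2 powr (real i * (1 + \<nu>)) * H * \<Omega> powr ((1 + \<nu>) / 2) / ((1 + \<nu>) * N powr ((1 + 3 * \<nu>) / 2))"
proof -
  define \<theta> where "\<theta> = (1 + \<nu>) / 2"
  define \<rho> where "\<rho> = (1 - \<nu>) / (1 + \<nu>)"
  have \<rho>: "\<rho> > 0" using \<nu> by (simp add: \<rho>_def)
  have \<theta>: "\<theta> > 0" using \<nu> by (simp add: \<theta>_def)
  define Y where "Y = H powr (2 / (1 + \<nu>))"
  define D where "D = (2::real) ^ (2 * i - 1)"
  have Y: "Y > 0" using H by (simp add: Y_def)
  have D: "D > 0" by (simp add: D_def)
  have half: "(1 - \<nu>) / (2 * (1 + \<nu>)) = \<rho> / 2" using \<nu> by (simp add: \<rho>_def)
  define K where "K = (\<rho> / 2) powr \<rho> * Y"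
  have K: "K > 0" using \<rho> Y by (simp add: K_def)
  define E where "E = \<rho> * D * K * \<Omega> / N ^ 3"
  have E: "E > 0" using \<rho> D K \<Omega> N by (simp add: E_def)
  have K_eq: "K_const \<nu> H = K"
    unfolding K_const_def half using \<nu> by (simp add: K_def Y_def \<rho>_def)
  have \<delta>_eq: "\<delta> = E powr \<theta>"
    using \<nu> by (simp add: \<delta>_def delta_opt_def K_eq E_def \<theta>_def \<rho>_def D_def)
  show pos: "0 < \<delta>" using E by (simp add: \<delta>_eq)
  have L_eq: "L_const \<nu> H \<delta> = K * \<delta> powr (- \<rho>)"
  proof -
    have "L_const \<nu> H \<delta> = (\<rho> / 2 * (1 / \<delta>)) powr \<rho> * Y"
      unfolding L_const_def half using \<nu> pos by (simp add: Y_def \<rho>_def)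
    then show ?thesis
      using pos \<rho> by (simp add: K_def powr_divide powr_mult powr_minus field_simps)
  qed
  have theta_rho: "\<theta> * (1 + \<rho>) = 1" "\<theta> * \<rho> = 1 - \<theta>" "\<theta> * (1 - \<rho>) = \<nu>"
    using \<nu> by (simp_all add: \<theta>_def \<rho>_def field_simps)
  have "\<delta> powr (- \<rho>) = \<delta> / E"
  proof -
    have "\<delta> powr (- \<rho>) = E powr (\<theta> - 1)"
      using theta_rho(2) by (simp add: \<delta>_eq powr_powr)
    then show ?thesis using E by (simp add: \<delta>_eq powr_diff)
  qed
  \<comment> \<open>The stationarity condition: the first term is \<open>1/\<rho>\<close> times the second.\<close>
  then have "D * L_const \<nu> H \<delta> * \<Omega> / N\<^sup>2 = N * \<delta> / \<rho>"
    using \<rho> D K \<Omega> N by (simp add: L_eq E_def field_simps power2_eq_square power3_eq_cube)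
  then have "D * L_const \<nu> H \<delta> * \<Omega> / N\<^sup>2 + N * \<delta> = (1 / \<rho> + 1) * N * E powr \<theta>"
    by (simp add: \<delta>_eq algebra_simps)
  also have "1 / \<rho> + 1 = 2 / (1 - \<nu>)"
    using \<nu> by (simp add: \<rho>_def field_simps)
  also have "E powr \<theta> = (\<rho> * D) powr \<theta> * ((\<rho> / 2) powr (1 - \<theta>) * H) * \<Omega> powr \<theta> / N powr (3 * \<theta>)"
  proof -
    have "K powr \<theta> = (\<rho> / 2) powr (1 - \<theta>) * H"
    proof -
      have "2 / (1 + \<nu>) * \<theta> = 1" using \<nu> by (simp add: \<theta>_def)
      then have "Y powr \<theta> = H" using H by (simp add: Y_def powr_powr)
      then show ?thesis using \<rho> Y theta_rho(2)
        by (simp add: K_def powr_mult powr_powr mult.commute)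
    qed
    moreover have "(N ^ 3) powr \<theta> = N powr (3 * \<theta>)"
      using N by (simp add: powr_powr flip: powr_numeral)
    ultimately show ?thesis
      using \<rho> D K \<Omega> N by (simp add: E_def powr_mult powr_divide)
  qed
  also have "(\<rho> * D) powr \<theta> * ((\<rho> / 2) powr (1 - \<theta>) * H) = \<rho> * H * 2 powr (real i * (1 + \<nu>)) / 2"
  proof -
    have "D = 2 powr (2 * real i - 1)"
      using i by (simp add: D_def of_nat_diff flip: powr_realpow)
    then have "D powr \<theta> = 2 powr ((2 * real i - 1) * \<theta>)"
      by (simp add: powr_powr)
    moreover have "(2 * real i - 1) * \<theta> - (1 - \<theta>) = real i * (1 + \<nu>) - 1"
      by (simp add: \<theta>_def field_simps)
    then have "2 powr ((2 * real i - 1) * \<theta>) / 2 powr (1 - \<theta>) = 2 powr (real i * (1 + \<nu>)) / (2::real)"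
      by (metis powr_diff powr_one zero_le_numeral)
    moreover have "\<rho> powr \<theta> * \<rho> powr (1 - \<theta>) = \<rho>"
      using \<rho> by (simp flip: powr_add)
    moreover have "(\<rho> * D) powr \<theta> * ((\<rho> / 2) powr (1 - \<theta>) * H)
        = (\<rho> powr \<theta> * \<rho> powr (1 - \<theta>)) * H * (D powr \<theta> / 2 powr (1 - \<theta>))"
      using \<rho> D by (simp add: powr_mult powr_divide)
    ultimately have "(\<rho> * D) powr \<theta> * ((\<rho> / 2) powr (1 - \<theta>) * H)
        = \<rho> * H * (2 powr (real i * (1 + \<nu>)) / 2)"
      by (simp only:)
    then show ?thesis by simp
  qed
  also have "2 / (1 - \<nu>) * N * (\<rho> * H * 2 powr (real i * (1 + \<nu>)) / 2 * \<Omega> powr \<theta> / N powr (3 * \<theta>))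
      = 2 powr (real i * (1 + \<nu>)) * H * \<Omega> powr \<theta> / (1 + \<nu>) * (N / N powr (3 * \<theta>))"
  proof -
    have "\<rho> / (1 - \<nu>) = 1 / (1 + \<nu>)" using \<nu> by (simp add: \<rho>_def)
    moreover have "2 / (1 - \<nu>) * N * (\<rho> * H * X / 2 * W / V) = \<rho> / (1 - \<nu>) * (H * X * W * N / V)"
      for X W V :: real by simp
    ultimately show ?thesis by simp
  qed
  also have "N / N powr (3 * \<theta>) = 1 / N powr ((1 + 3 * \<nu>) / 2)"
  proof -
    have "3 * \<theta> = 1 + (1 + 3 * \<nu>) / 2" by (simp add: \<theta>_def field_simps)
    then show ?thesis using N by (simp add: powr_add)
  qed
  finally show "2 ^ (2 * i - 1) * L_const \<nu> H \<delta> * \<Omega> / N\<^sup>2 + N * \<delta>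
      = 2 powr (real i * (1 + \<nu>)) * H * \<Omega> powr ((1 + \<nu>) / 2) / ((1 + \<nu>) * N powr ((1 + 3 * \<nu>) / 2))"
    by (simp add: D_def \<theta>_def)
qed

lemma delta_opt_eq_0: "\<nu> = 1 \<or> H = 0 \<or> \<Omega> = 0 \<Longrightarrow> delta_opt \<nu> H \<Omega> i N = 0"
  by (auto simp: delta_opt_def K_const_def)

text \<open>
  The degenerate values \<open>\<nu> = 1\<close>, \<open>H = 0\<close> and \<open>\<Omega> = 0\<close> all have \<open>\<delta> = 0\<close>. For \<open>\<Omega> = 0\<close> and \<open>\<nu> < 1\<close> also
  \<open>L = 0\<close>, so the right-hand side vanishes. The hypothesis \<open>r = 0\<close> expresses that the feasible set is
  then a single point.
\<close>

lemma holder_term_le_tuned_quadratic: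
  assumes "0 \<le> \<nu>" "\<nu> \<le> 1" "0 \<le> H" "0 \<le> \<Omega>" "0 < N" "i \<ge> 1" "0 \<le> r" "\<Omega> = 0 \<Longrightarrow> r = 0"
  defines "\<delta> \<equiv> delta_opt \<nu> H \<Omega> i N"
  shows "H / (1 + \<nu>) * r powr (1 + \<nu>) \<le> L_const \<nu> H \<delta> / 2 * r\<^sup>2 + \<delta>"
proof (cases "\<nu> < 1 \<and> H > 0 \<and> \<Omega> > 0")
  case True
  then show ?thesis
    unfolding \<delta>_def using assms
    by (intro powr_le_quadratic_plus_error optimal_delta_value(1)) auto
next
  case False
  then consider "\<nu> = 1" | "\<nu> < 1" "H = 0" | "\<Omega> = 0" using assms by fastforce
  then show ?thesis
    using assms by cases (auto simp: delta_opt_eq_0 L_const_def)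
qed

lemma tuned_bound_value:
  assumes "0 \<le> \<nu>" "\<nu> \<le> 1" "0 \<le> H" "0 \<le> \<Omega>" "0 < N" "i \<ge> 1"
  defines "\<delta> \<equiv> delta_opt \<nu> H \<Omega> i N"
  shows "2 ^ (2 * i - 1) * L_const \<nu> H \<delta> * \<Omega> / N\<^sup>2 + N * \<delta>
      = 2 powr (real i * (1 + \<nu>)) * H * \<Omega> powr ((1 + \<nu>) / 2) / ((1 + \<nu>) * N powr ((1 + 3 * \<nu>) / 2))"
proof (cases "\<nu> < 1 \<and> H > 0 \<and> \<Omega> > 0")
  case True
  then show ?thesis
    unfolding \<delta>_def using assms by (intro optimal_delta_value(2)) auto
next
  case False
  then consider "\<nu> = 1" | "\<nu> < 1" "H = 0" | "\<Omega> = 0" using assms by fastforce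
  then show ?thesis
  proof cases
    case 1
    have "(2::real) powr (real i * 2) = 2 ^ (i * 2)"
      by (simp flip: powr_realpow)
    also have "\<dots> = 2 * 2 ^ (2 * i - 1)"
      using assms(6) by (simp flip: power_Suc add: mult.commute)
    finally show ?thesis
      using 1 assms by (simp add: delta_opt_eq_0 L_const_def)
  qed (use assms in \<open>auto simp: delta_opt_eq_0 L_const_def\<close>)
qed

section \<open>Multi-indices and feasibility of the iterates\<close>

text \<open>
  Level \<open>i\<close> enters the procedure called at \<open>t\<close> with its variable stored under \<open>t\<close> followed by zeros.
\<close>

definition zero_pad :: "nat list \<Rightarrow> nat \<Rightarrow> nat list" where
  "zero_pad t i = t @ replicate (i - length t) 0"

lemma zero_pad_length [simp]: "zero_pad t (length t) = t"
  by (simp add: zero_pad_def)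

lemma zero_pad_snoc_0: "length t < i \<Longrightarrow> zero_pad (t @ [0]) i = zero_pad t i"
  by (simp add: zero_pad_def Suc_diff_Suc flip: replicate_Suc)

lemma multi_indices_snoc:
  "t \<in> multi_indices T k \<Longrightarrow> j < T (Suc k) \<Longrightarrow> t @ [j] \<in> multi_indices T (Suc k)"
  by (auto simp: multi_indices_def nth_append less_Suc_eq)

lemma multi_indices_snocD:
  assumes "t @ [j] \<in> multi_indices T k"
  shows "k = Suc (length t)" "t \<in> multi_indices T (length t)" "j < T (Suc (length t))"
  using assms by (auto simp: multi_indices_def nth_append dest: spec[of _ "length t"] split: if_splits)

lemma multi_indices_take:
  "t \<in> multi_indices T k \<Longrightarrow> i \<le> k \<Longrightarrow> take i t \<in> multi_indices T i"
  by (auto simp: multi_indices_def)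

lemma length_multi_indices: "t \<in> multi_indices T k \<Longrightarrow> length t = k"
  by (simp add: multi_indices_def)

text \<open>
  A run for which each \<open>p\<^sub>i\<close> satisfies a descent inequality with constant \<open>L\<^sub>i\<close> and additive error
  \<open>\<delta>\<^sub>i\<close>, which is the form in which the smoothness of \<open>p\<^sub>i\<close> enters the analysis of the loops. The descent
  inequality is conditional on a feasible query point, because feasibility is a consequence of the
  other assumptions (\<open>embed_in\<close>).
\<close>

locale sliding_descent =
  fixes P :: "real^'d^'d" and Z :: "(real^'d) set" and n :: nat
    and p :: "nat \<Rightarrow> real^'d \<Rightarrow> real" and Q :: "nat \<Rightarrow> real^'d \<Rightarrow> real^'d"
    and T :: "nat \<Rightarrow> nat" and L M \<delta> :: "nat \<Rightarrow> real"
    and zin :: "real^'d" and g z zbar ztil Rec :: "nat list \<Rightarrow> real^'d"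
  assumes P: "sym_pos_def P" and Z: "convex Z" and zin: "zin \<in> Z"
    and run: "sliding_run P Z n Q T sliding_alpha (sliding_step L M T) zin g z zbar ztil Rec"
    and T: "\<And>i. i \<in> {1..n} \<Longrightarrow> T i \<ge> 1"
    and LM: "\<And>i. i \<in> {1..n} \<Longrightarrow> L i \<ge> 0 \<and> M i \<ge> 0 \<and> \<delta> i \<ge> 0"
    and Q_mono: "\<And>i. i \<in> {1..n} \<Longrightarrow> monotone_operator Z (Q i)"
    and Q_lip: "\<And>i. i \<in> {1..n} \<Longrightarrow> lipschitz_operator P Z (M i) (Q i)"
    and p_convex: "\<And>i. i \<in> {1..n} \<Longrightarrow> convex_on Z (p i)"
    and g_subgradient: "\<And>i t y. i \<in> {1..n} \<Longrightarrow> t \<in> multi_indices T i \<Longrightarrow> y \<in> Z \<Longrightarrow>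
      p i (query_point sliding_alpha z zbar t)
        + g t \<bullet> (y - query_point sliding_alpha z zbar t) \<le> p i y"
    and descent: "\<And>i t y. i \<in> {1..n} \<Longrightarrow> t \<in> multi_indices T i \<Longrightarrow> y \<in> Z \<Longrightarrow>
      query_point sliding_alpha z zbar t \<in> Z \<Longrightarrow>
      p i y \<le> p i (query_point sliding_alpha z zbar t)
        + g t \<bullet> (y - query_point sliding_alpha z zbar t)
        + L i / 2 * (mnorm P (y - query_point sliding_alpha z zbar t))\<^sup>2 + \<delta> i"
begin

abbreviation "\<alpha> \<equiv> sliding_alpha"
abbreviation "\<eta> \<equiv> sliding_step L M T"

text \<open>
  The two summands of the step size are proportional to \<open>scale\<close> and to \<open>rel_scale\<close>. The latter is
  normalised so as never to fall below 1, which keeps the step sizes at least \<open>L scale + M\<close>.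
\<close>

definition scale :: "nat list \<Rightarrow> real" where
  "scale t = (\<Prod>l<length t. \<alpha> (t ! l))"

definition rel_scale :: "nat list \<Rightarrow> real" where
  "rel_scale t = (\<Prod>l<length t. \<alpha> (t ! l) / \<alpha> (T (Suc l) - 1))"

text \<open>
  The composition of the averaging maps that defines the query point, as a function of its argument.
\<close>

definition embed :: "nat list \<Rightarrow> real^'d \<Rightarrow> real^'d" where
  "embed t x = foldr (\<lambda>l y. \<alpha> (t ! l) *\<^sub>R y + (1 - \<alpha> (t ! l)) *\<^sub>R zbar (take (Suc l) t))
     [0..<length t] x"

lemma embed_Nil [simp]: "embed [] x = x"
  by (simp add: embed_def)

lemma embed_snoc: "embed (t @ [j]) x = embed t (\<alpha> j *\<^sub>R x + (1 - \<alpha> j) *\<^sub>R zbar (t @ [j]))"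
proof -
  have "foldr (\<lambda>l y. \<alpha> ((t @ [j]) ! l) *\<^sub>R y + (1 - \<alpha> ((t @ [j]) ! l)) *\<^sub>R zbar (take (Suc l) (t @ [j])))
      [0..<length t] y
    = foldr (\<lambda>l y. \<alpha> (t ! l) *\<^sub>R y + (1 - \<alpha> (t ! l)) *\<^sub>R zbar (take (Suc l) t)) [0..<length t] y" for y
    by (rule foldr_cong) (auto simp: nth_append)
  then show ?thesis by (simp add: embed_def)
qed

lemma query_point_eq: "query_point \<alpha> z zbar t = embed t (z t)"
  by (simp add: query_point_def embed_def)

lemma scale_pos: "scale t > 0"
  unfolding scale_def by (intro prod_pos) (simp add: sliding_alpha_pos)

lemma scale_snoc: "scale (t @ [j]) = scale t * \<alpha> j"
  by (simp add: scale_def nth_append)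

lemma rel_scale_snoc: "rel_scale (t @ [j]) = rel_scale t * (\<alpha> j / \<alpha> (T (Suc (length t)) - 1))"
  by (simp add: rel_scale_def nth_append)

lemma rel_scale_ge_1:
  assumes "t \<in> multi_indices T k"
  shows "rel_scale t \<ge> 1"
  unfolding rel_scale_def
proof (rule prod_ge_1)
  fix l assume "l \<in> {..<length t}"
  then have "t ! l \<le> T (Suc l) - 1"
    using assms by (fastforce simp: multi_indices_def)
  then show "1 \<le> \<alpha> (t ! l) / \<alpha> (T (Suc l) - 1)"
    using sliding_alpha_antimono sliding_alpha_pos by (simp add: le_divide_eq)
qed

lemma step_size_eq: "\<eta> t = L (length t) * scale t + M (length t) * rel_scale t"
  by (simp add: sliding_step_def scale_def rel_scale_def)

lemma step_size_nonneg:
  assumes "t \<in> multi_indices T k" "k \<in> {1..n}"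
  shows "\<eta> t \<ge> 0"
  using LM[OF assms(2)] scale_pos[of t] rel_scale_ge_1[OF assms(1)] length_multi_indices[OF assms(1)]
  by (simp add: step_size_eq)

lemma embed_affine: "embed t (a *\<^sub>R x + (1 - a) *\<^sub>R y) = a *\<^sub>R embed t x + (1 - a) *\<^sub>R embed t y"
proof (induction t arbitrary: x y rule: rev_induct)
  case (snoc j t)
  have "\<alpha> j *\<^sub>R (a *\<^sub>R x + (1 - a) *\<^sub>R y) + (1 - \<alpha> j) *\<^sub>R zbar (t @ [j])
    = a *\<^sub>R (\<alpha> j *\<^sub>R x + (1 - \<alpha> j) *\<^sub>R zbar (t @ [j]))
      + (1 - a) *\<^sub>R (\<alpha> j *\<^sub>R y + (1 - \<alpha> j) *\<^sub>R zbar (t @ [j]))"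
    by (simp add: algebra_simps)
  then show ?case by (simp only: embed_snoc snoc)
qed simp

lemma embed_diff: "embed t x - embed t y = scale t *\<^sub>R (x - y)"
proof (induction t arbitrary: x y rule: rev_induct)
  case (snoc j t)
  show ?case
    unfolding embed_snoc snoc scale_snoc by (simp add: algebra_simps)
qed (simp add: scale_def)

lemma z_start: "i \<in> {1..n} \<Longrightarrow> z (zero_pad [] i) = zin"
  using run by (simp add: sliding_run_def zero_pad_def)

lemma Rec_innermost:
  assumes "t \<in> multi_indices T n"
  shows "is_arg_min
          (\<lambda>x. \<Sum>i = 1..n. (g (take i t) + Q i (z (take i t))) \<bullet> x
                 + 1/2 * \<eta> (take i t) * (mnorm P (x - z (take i t)))\<^sup>2)
          (\<lambda>x. x \<in> Z) (Rec t)"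
  using run assms unfolding sliding_run_def by blast

context
  fixes t k assumes t: "t \<in> multi_indices T k" and k: "k < n"
begin

lemma loop_facts:
  "zbar (t @ [0]) = z (t @ [0]) \<and>
    (\<forall>j<T (k+1).
           let t' = t @ [j]; t'' = t @ [j+1] in
             ztil t' = Rec t' \<and>
             zbar t'' = \<alpha> j *\<^sub>R ztil t' + (1 - \<alpha> j) *\<^sub>R zbar t' \<and>
             is_arg_min
               (\<lambda>x. (Q (k+1) (ztil t') - Q (k+1) (z t')) \<bullet> x
                      + 1/2 * \<eta> t' * (mnorm P (x - ztil t'))\<^sup>2)
               (\<lambda>x. x \<in> Z) (z t'') \<and>
             (\<forall>l\<in>{k+2..n}. z (t'' @ replicate (l - (k+1)) 0)
                = z (t' @ [T (k+2)] @ replicate (l - (k+2)) 0))) \<and>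
        Rec t = zbar (t @ [T (k+1)])"
  using run t k unfolding sliding_run_def by blast

lemma zbar_0: "zbar (t @ [0]) = z (t @ [0])"
  using loop_facts by blast

lemma Rec_eq: "Rec t = zbar (t @ [T (Suc k)])"
  using loop_facts by simp

lemma zbar_Suc:
  "j < T (Suc k) \<Longrightarrow> zbar (t @ [Suc j]) = \<alpha> j *\<^sub>R Rec (t @ [j]) + (1 - \<alpha> j) *\<^sub>R zbar (t @ [j])"
  using loop_facts by (simp add: Let_def)

lemma z_Suc_arg_min:
  assumes j: "j < T (Suc k)"
  shows "is_arg_min
     (\<lambda>x. (Q (Suc k) (Rec (t @ [j])) - Q (Suc k) (z (t @ [j]))) \<bullet> x
        + 1/2 * \<eta> (t @ [j]) * (mnorm P (x - Rec (t @ [j])))\<^sup>2)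
     (\<lambda>x. x \<in> Z) (z (t @ [Suc j]))"
proof -
  have "is_arg_min
     (\<lambda>x. (Q (k+1) (ztil (t @ [j])) - Q (k+1) (z (t @ [j]))) \<bullet> x
        + 1/2 * \<eta> (t @ [j]) * (mnorm P (x - ztil (t @ [j])))\<^sup>2)
     (\<lambda>x. x \<in> Z) (z (t @ [j+1]))" "ztil (t @ [j]) = Rec (t @ [j])"
    using loop_facts j unfolding Let_def Suc_eq_plus1 by blast+
  then show ?thesis by (simp only: Suc_eq_plus1)
qed

lemma z_warm_start:
  assumes "j < T (Suc k)" "l \<in> {Suc (Suc k)..n}"
  shows "z (zero_pad (t @ [Suc j]) l) = z (zero_pad (t @ [j] @ [T (Suc (Suc k))]) l)"
proof -
  have "z ((t @ [Suc j]) @ replicate (l - Suc k) 0)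
      = z ((t @ [j]) @ [T (Suc (Suc k))] @ replicate (l - Suc (Suc k)) 0)"
    using loop_facts assms by (auto simp: Let_def)
  then show ?thesis
    using length_multi_indices[OF t] by (simp add: zero_pad_def)
qed

end

text \<open>
  The gap analysis evaluates \<open>p\<^sub>i\<close> and \<open>Q\<^sub>i\<close> at iterates, so these must be feasible. Every argmin is;
  the warm starts copy the final value of the inner loop, so the statement for the procedure at
  level \<open>k\<close> must include the final values at all deeper levels, and the induction runs from the
  innermost level outwards.
\<close>

lemma loop_in_feasible_set:
  assumes "t \<in> multi_indices T k" "k \<le> n"
    and "\<And>i. i \<in> {Suc k..n} \<Longrightarrow> z (zero_pad t i) \<in> Z"
  shows "Rec t \<in> Z \<and> (k < n \<longrightarrow> (\<forall>j\<le>T (Suc k). zbar (t @ [j]) \<in> Z \<and>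
           (\<forall>i\<in>{Suc k..n}. z (zero_pad (t @ [j]) i) \<in> Z)))"
  using assms(2,1,3)
proof (induction k arbitrary: t rule: inc_induct)
  case base
  then show ?case using Rec_innermost[of t] by (simp add: is_arg_min_def)
next
  case (step k)
  note t = step.prems(1) and k = step.hyps(2)
  have len: "length t = k" by (rule length_multi_indices[OF t])
  have *: "zbar (t @ [j]) \<in> Z \<and> (\<forall>i\<in>{Suc k..n}. z (zero_pad (t @ [j]) i) \<in> Z)"
    if "j \<le> T (Suc k)" for j
    using that
  proof (induction j)
    case 0
    have "z (zero_pad (t @ [0]) i) \<in> Z" if "i \<in> {Suc k..n}" for i
      using step.prems(2)[OF that] that len by (simp add: zero_pad_snoc_0)
    moreover have "zero_pad (t @ [0]) (Suc k) = t @ [0]"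
      using len by (simp add: zero_pad_def)
    ultimately show ?case
      using k zbar_0[OF t k] by (metis atLeastAtMost_iff Suc_leI order_refl)
  next
    case (Suc j)
    then have j: "j < T (Suc k)" by simp
    have tj: "t @ [j] \<in> multi_indices T (Suc k)"
      using t j by (rule multi_indices_snoc)
    have inner: "Rec (t @ [j]) \<in> Z \<and> (Suc k < n \<longrightarrow> (\<forall>j'\<le>T (Suc (Suc k)). zbar ((t @ [j]) @ [j']) \<in> Z \<and>
        (\<forall>i\<in>{Suc (Suc k)..n}. z (zero_pad ((t @ [j]) @ [j']) i) \<in> Z)))"
      using Suc by (intro step.IH tj) auto
    have "zbar (t @ [Suc j]) \<in> Z"
      unfolding zbar_Suc[OF t k j] using Z inner Suc sliding_alpha_pos[of j] sliding_alpha_le_1[of j]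
      by (intro convexD) (auto intro: less_imp_le)
    moreover have "z (zero_pad (t @ [Suc j]) i) \<in> Z" if i: "i \<in> {Suc k..n}" for i
    proof (cases "i = Suc k")
      case True
      then show ?thesis
        using z_Suc_arg_min[OF t k j] len by (simp add: is_arg_min_def zero_pad_def)
    next
      case False
      then have i': "i \<in> {Suc (Suc k)..n}" using i by auto
      then show ?thesis
        unfolding z_warm_start[OF t k j i'] using inner by auto
    qed
    ultimately show ?case by blast
  qed
  moreover have "Rec t \<in> Z"
    unfolding Rec_eq[OF t k] using * by blast
  ultimately show ?case by blast
qed

lemma start_in_feasible_set:
  "t \<in> multi_indices T k \<Longrightarrow> k \<le> n \<Longrightarrow> i \<in> {Suc k..n} \<Longrightarrow> z (zero_pad t i) \<in> Z"
proof (induction t arbitrary: k i rule: rev_induct)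
  case Nil
  then show ?case using z_start[of i] zin by (simp add: multi_indices_def)
next
  case (snoc j t)
  note D = multi_indices_snocD[OF snoc.prems(1)]
  have "z (zero_pad t i') \<in> Z" if "i' \<in> {Suc (length t)..n}" for i'
    using snoc.IH[OF D(2) _ that] that by auto
  then show ?case
    using loop_in_feasible_set[OF D(2)] snoc.prems D by fastforce
qed

lemma Rec_in: "t \<in> multi_indices T k \<Longrightarrow> k \<le> n \<Longrightarrow> Rec t \<in> Z"
  using loop_in_feasible_set start_in_feasible_set by blast

lemma zbar_in: "t \<in> multi_indices T k \<Longrightarrow> k < n \<Longrightarrow> j \<le> T (Suc k) \<Longrightarrow> zbar (t @ [j]) \<in> Z"
  using loop_in_feasible_set start_in_feasible_set by (metis less_imp_le)

lemma z_in: "t \<in> multi_indices T k \<Longrightarrow> k < n \<Longrightarrow> j \<le> T (Suc k) \<Longrightarrow> z (t @ [j]) \<in> Z"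
proof -
  assume a: "t \<in> multi_indices T k" "k < n" "j \<le> T (Suc k)"
  then have "z (zero_pad (t @ [j]) (Suc k)) \<in> Z"
    using loop_in_feasible_set[of t k] start_in_feasible_set[of t k] by auto
  then show ?thesis using length_multi_indices[OF a(1)] by (simp add: zero_pad_def)
qed

lemma embed_in: "t \<in> multi_indices T k \<Longrightarrow> k \<le> n \<Longrightarrow> x \<in> Z \<Longrightarrow> embed t x \<in> Z"
proof (induction t arbitrary: k x rule: rev_induct)
  case (snoc j t)
  note D = multi_indices_snocD[OF snoc.prems(1)]
  have "zbar (t @ [j]) \<in> Z"
    using zbar_in[OF D(2)] D snoc.prems(2) by simp
  then have "\<alpha> j *\<^sub>R x + (1 - \<alpha> j) *\<^sub>R zbar (t @ [j]) \<in> Z"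
    using Z snoc.prems(3) sliding_alpha_pos[of j] sliding_alpha_le_1[of j]
    by (intro convexD) (auto intro: less_imp_le)
  then show ?case
    unfolding embed_snoc using snoc.IH[OF D(2)] snoc.prems(2) D(1) by simp
qed simp

section \<open>The gap and its decrease\<close>

text \<open>
  The summand of a level \<open>i \<le> k\<close>, whose oracle vectors are fixed during the call at level \<open>k\<close>:
  linearised objective minus the right-hand side of the three-point inequality.
\<close>

definition prox_term :: "nat list \<Rightarrow> real^'d \<Rightarrow> real^'d \<Rightarrow> real" where
  "prox_term t x u = (g t + Q (length t) (z t)) \<bullet> (x - u)
     - \<eta> t / 2 * ((mnorm P (u - z t))\<^sup>2 - (mnorm P (x - z t))\<^sup>2 - (mnorm P (u - x))\<^sup>2)"

text \<open>
  The summand of a level \<open>i > k\<close>: the true error of the rescaled function.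
\<close>

definition merit_term :: "nat \<Rightarrow> nat list \<Rightarrow> real^'d \<Rightarrow> real^'d \<Rightarrow> real" where
  "merit_term i t x u = (p i (embed t x) - p i (embed t u)) / scale t + Q i u \<bullet> (x - u)"

definition gap :: "nat list \<Rightarrow> real^'d \<Rightarrow> real^'d \<Rightarrow> real" where
  "gap t x u = (\<Sum>i = 1..length t. prox_term (take i t) x u)
     + (\<Sum>i = Suc (length t)..n. merit_term i t x u)"

text \<open>
  The coefficient with which the squared distance of \<open>u\<close> to the iterate of level \<open>i\<close> enters the bound
  for the call at \<open>t\<close>. At the level of \<open>t\<close> itself it is half the step size; each loop left on
  the way out multiplies it by \<open>\<alpha>\<^bsub>T-1\<^esub>\<^sup>2 / \<alpha>\<^sub>j\<close>. Similarly \<open>err\<close> is the accumulated descent error.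
\<close>

definition rate :: "nat \<Rightarrow> nat list \<Rightarrow> real" where
  "rate i t = (L i * scale t * (\<Prod>l = Suc (length t)..i. (\<alpha> (T l - 1))\<^sup>2)
     + M i * rel_scale t * (\<Prod>l = Suc (length t)..i. \<alpha> (T l - 1))) / 2"

definition err :: "nat \<Rightarrow> nat list \<Rightarrow> real" where
  "err i t = \<delta> i * (\<Prod>l = Suc (length t)..i. real (T l)) / scale t"

definition dist2 :: "nat \<Rightarrow> nat list \<Rightarrow> real^'d \<Rightarrow> real" where
  "dist2 i t u = (mnorm P (u - z (zero_pad t i)))\<^sup>2"

lemma prox_term_convex:
  assumes "\<eta> t \<ge> 0" "0 \<le> a" "a \<le> 1"
  shows "prox_term t (a *\<^sub>R x + (1 - a) *\<^sub>R y) u \<le> a * prox_term t x u + (1 - a) * prox_term t y u"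
proof -
  define v where "v = a *\<^sub>R x + (1 - a) *\<^sub>R y"
  have v: "v - z t = a *\<^sub>R (x - z t) + (1 - a) *\<^sub>R (y - z t)" "u - v = a *\<^sub>R (u - x) + (1 - a) *\<^sub>R (u - y)"
    by (simp_all add: v_def algebra_simps)
  have "(mnorm P (v - z t))\<^sup>2 \<le> a * (mnorm P (x - z t))\<^sup>2 + (1 - a) * (mnorm P (y - z t))\<^sup>2"
    "(mnorm P (u - v))\<^sup>2 \<le> a * (mnorm P (u - x))\<^sup>2 + (1 - a) * (mnorm P (u - y))\<^sup>2"
    unfolding v by (rule mnorm_power2_convex[OF P assms(2,3)])+
  then have "(mnorm P (v - z t))\<^sup>2 + (mnorm P (u - v))\<^sup>2
      \<le> a * ((mnorm P (x - z t))\<^sup>2 + (mnorm P (u - x))\<^sup>2)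
        + (1 - a) * ((mnorm P (y - z t))\<^sup>2 + (mnorm P (u - y))\<^sup>2)"
    unfolding distrib_left by linarith
  from mult_left_mono[OF this, of "\<eta> t / 2"] assms(1)
  moreover have "(g t + Q (length t) (z t)) \<bullet> (v - u)
      = a * ((g t + Q (length t) (z t)) \<bullet> (x - u)) + (1 - a) * ((g t + Q (length t) (z t)) \<bullet> (y - u))"
    by (simp add: v_def inner_simps algebra_simps)
  ultimately show ?thesis
    unfolding v_def[symmetric] prox_term_def by (simp add: algebra_simps add_divide_distrib diff_divide_distrib)
qed

context
  fixes t k j u
  assumes t: "t \<in> multi_indices T k" and k: "k < n" and j: "j < T (Suc k)" and u: "u \<in> Z"
begin

abbreviation (input) "t' \<equiv> t @ [j]"
abbreviation (input) "t'' \<equiv> t @ [Suc j]"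

lemma len_t: "length t = k"
  by (rule length_multi_indices[OF t])

lemma t': "t' \<in> multi_indices T (Suc k)"
  by (rule multi_indices_snoc[OF t j])

lemma in_Z: "Rec t' \<in> Z" "z t' \<in> Z" "z t'' \<in> Z" "zbar t' \<in> Z" "zbar t'' \<in> Z"
  using Rec_in[OF t'] z_in[OF t k] zbar_in[OF t k] k j by auto

lemma alpha_j: "0 \<le> \<alpha> j" "\<alpha> j \<le> 1" "0 < \<alpha> j"
  using sliding_alpha_pos[of j] sliding_alpha_le_1[of j] by auto

lemma embed_zbar: "embed t (zbar t'') = embed t' (Rec t')"
  unfolding zbar_Suc[OF t k j] embed_snoc ..

text \<open>
  The two proximal steps for \<open>Q\<close>. Replacing \<open>Q(u)\<close> by \<open>Q(x)\<close> costs nothing by monotonicity, where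
  \<open>x\<close> is the point returned by the inner call. The inner call has accounted for \<open>Q(z)\<close>; the remaining
  \<open>\<langle>Q(x) - Q(z), x - u\<rangle>\<close> is split at the next iterate \<open>v\<close>. The part at \<open>v - u\<close> is controlled by the second
  proximal step, the part at \<open>x - v\<close> by the Lipschitz bound \<open>M \<parallel>x - z\<parallel> \<parallel>x - v\<parallel>\<close>, which the negative
  squares of both steps absorb since \<open>\<eta> \<ge> L scale + M\<close>. A surplus \<open>L scale \<parallel>x - z\<parallel>\<^sup>2 / 2\<close> is left
  to pay for the descent inequality.
\<close>

lemma extragradient_step:
  "g t' \<bullet> (Rec t' - u) + Q (Suc k) u \<bullet> (Rec t' - u)
    \<le> prox_term t' (Rec t') u + \<eta> t' / 2 * ((mnorm P (u - z t'))\<^sup>2 - (mnorm P (u - z t''))\<^sup>2)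
      - L (Suc k) * scale t' / 2 * (mnorm P (Rec t' - z t'))\<^sup>2"
proof -
  define x y v where "x = Rec t'" and "y = z t'" and "v = z t''"
  define d where "d = Q (Suc k) x - Q (Suc k) y"
  define a b where "a = mnorm P (x - y)" and "b = mnorm P (x - v)"
  have i: "Suc k \<in> {1..n}" using k by simp
  have xyv: "x \<in> Z" "y \<in> Z" "v \<in> Z" using in_Z by (simp_all add: x_def y_def v_def)
  have "is_arg_min (\<lambda>w. \<Sum>i\<in>{()}. d \<bullet> w + 1/2 * \<eta> t' * (mnorm P (w - x))\<^sup>2) (\<lambda>w. w \<in> Z) v"
    using z_Suc_arg_min[OF t k j] by (simp add: d_def x_def y_def v_def)
  from prox_three_point[OF P Z this u]
  have prox: "d \<bullet> (v - u) \<le> \<eta> t' / 2 * ((mnorm P (u - x))\<^sup>2 - b\<^sup>2 - (mnorm P (u - v))\<^sup>2)"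
    by (simp add: b_def mnorm_minus_commute[of P x v])
  have mono: "Q (Suc k) u \<bullet> (x - u) \<le> Q (Suc k) x \<bullet> (x - u)"
    using Q_mono[OF i] xyv u unfolding monotone_operator_def by (fastforce simp: inner_diff_left)
  have "d \<bullet> (x - v) \<le> mnorm_dual P d * b"
    unfolding b_def by (rule inner_le_mnorm_dual[OF P])
  also have "\<dots> \<le> M (Suc k) * a * b"
    using Q_lip[OF i] xyv unfolding lipschitz_operator_def d_def a_def b_def
    by (intro mult_right_mono) (auto simp: mnorm_nonneg[OF P])
  \<comment> \<open>Young's inequality splits the Lipschitz term evenly between the two squares.\<close>
  also have "\<dots> \<le> M (Suc k) * ((a\<^sup>2 + b\<^sup>2) / 2)"
    using LM[OF i] sum_squares_bound[of a b]
    by (auto simp: mult.assoc intro!: mult_left_mono)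
  finally have cs: "d \<bullet> (x - v) \<le> M (Suc k) * ((a\<^sup>2 + b\<^sup>2) / 2)" .
  have eta: "L (Suc k) * scale t' + M (Suc k) \<le> \<eta> t'"
    using mult_left_mono[OF rel_scale_ge_1[OF t'], of "M (Suc k)"] LM[OF i]
      length_multi_indices[OF t'] by (simp add: step_size_eq)
  have eta_M: "M (Suc k) \<le> \<eta> t'"
  proof -
    have "0 \<le> L (Suc k) * scale t'" using LM[OF i] scale_pos[of t'] by simp
    then show ?thesis using eta by simp
  qed
  have quad: "M (Suc k) * ((a\<^sup>2 + b\<^sup>2) / 2) + L (Suc k) * scale t' / 2 * a\<^sup>2 \<le> \<eta> t' / 2 * (a\<^sup>2 + b\<^sup>2)"
    using mult_right_mono[OF eta, of "a\<^sup>2"] mult_right_mono[OF eta_M, of "b\<^sup>2"]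
    by (simp add: algebra_simps add_divide_distrib)
  have "g t' \<bullet> (x - u) + Q (Suc k) u \<bullet> (x - u)
      \<le> (g t' + Q (Suc k) y) \<bullet> (x - u) + (d \<bullet> (x - v) + d \<bullet> (v - u))"
    using mono by (simp add: d_def inner_simps)
  also have "\<dots> \<le> (g t' + Q (Suc k) y) \<bullet> (x - u) + (M (Suc k) * ((a\<^sup>2 + b\<^sup>2) / 2)
      + \<eta> t' / 2 * ((mnorm P (u - x))\<^sup>2 - b\<^sup>2 - (mnorm P (u - v))\<^sup>2))"
    using prox cs by simp
  also have "\<dots> \<le> (g t' + Q (Suc k) y) \<bullet> (x - u)
      + (\<eta> t' / 2 * (a\<^sup>2 + b\<^sup>2) - L (Suc k) * scale t' / 2 * a\<^sup>2
      + \<eta> t' / 2 * ((mnorm P (u - x))\<^sup>2 - b\<^sup>2 - (mnorm P (u - v))\<^sup>2))"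
    using quad by simp
  finally show ?thesis
    using len_t unfolding prox_term_def x_def y_def v_def a_def
    by (simp add: algebra_simps add_divide_distrib diff_divide_distrib)
qed

text \<open>
  The accelerated step for \<open>p\<^sub>i\<close> at the level of the running loop. The image of the new average and the
  query point are the images of \<open>x\<close> and \<open>z\<close> under \<open>embed t'\<close>, so they differ by \<open>scale t' (x - z)\<close> and
  the quadratic term of the descent inequality gains a factor \<open>scale t'\<^sup>2\<close>; subgradient inequalities at the previous
  average and at \<open>u\<close> supply the factor \<open>1 - \<alpha>\<^sub>j\<close>.
\<close>

lemma merit_term_current:
  "merit_term (Suc k) t (zbar t'') u
    \<le> \<alpha> j * (prox_term t' (Rec t') u
        + (rate (Suc k) t' * (dist2 (Suc k) t' u - dist2 (Suc k) t'' u) + err (Suc k) t'))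
      + (1 - \<alpha> j) * merit_term (Suc k) t (zbar t') u"
proof -
  define i where "i = Suc k"
  have i: "i \<in> {1..n}" using k by (simp add: i_def)
  define x y where "x = Rec t'" and "y = z t'"
  define s a where "s = scale t" and "a = \<alpha> j"
  have s: "s > 0" and a: "a > 0" "a \<le> 1"
    using scale_pos alpha_j by (auto simp: s_def a_def)
  have s': "scale t' = s * a" by (simp add: s_def a_def scale_snoc)
  define w where "w = embed t' y"
  define E where "E = embed t"
  have w_eq: "w = query_point \<alpha> z zbar t'" by (simp add: w_def y_def query_point_eq)
  have EZ: "E v \<in> Z" if "v \<in> Z" for v
    unfolding E_def using embed_in[OF t] k that by simp
  have wZ: "w \<in> Z"
    unfolding w_def y_def using embed_in[OF t'] k in_Z by simp
  have t'i: "t' \<in> multi_indices T i" using t' by (simp add: i_def)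
  have E_zbar: "E (zbar t'') = embed t' x" by (simp add: E_def x_def embed_zbar)
  have up: "p i (E (zbar t'')) \<le> p i w + g t' \<bullet> (E (zbar t'') - w)
      + L i / 2 * (mnorm P (E (zbar t'') - w))\<^sup>2 + \<delta> i"
    unfolding w_eq using descent[OF i t'i EZ[OF in_Z(5)]] wZ w_eq by simp
  have low1: "p i w + g t' \<bullet> (E (zbar t') - w) \<le> p i (E (zbar t'))"
    unfolding w_eq using g_subgradient[OF i t'i EZ[OF in_Z(4)]] by simp
  have low2: "p i w + g t' \<bullet> (E u - w) \<le> p i (E u)"
    unfolding w_eq using g_subgradient[OF i t'i EZ[OF u]] by simp
  have dist_w: "(mnorm P (E (zbar t'') - w))\<^sup>2 = (s * a)\<^sup>2 * (mnorm P (x - y))\<^sup>2"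
    unfolding E_zbar w_def embed_diff s' by (simp add: mnorm_scaleR power_mult_distrib)
  have "E (zbar t'') = a *\<^sub>R E x + (1 - a) *\<^sub>R E (zbar t')"
    unfolding E_def zbar_Suc[OF t k j] embed_affine by (simp add: a_def x_def)
  then have "E (zbar t'') - a *\<^sub>R E u - (1 - a) *\<^sub>R E (zbar t') = a *\<^sub>R (E x - E u)"
    by (simp add: algebra_simps)
  then have Ediff: "E (zbar t'') - a *\<^sub>R E u - (1 - a) *\<^sub>R E (zbar t') = (a * s) *\<^sub>R (x - u)"
    by (simp add: E_def embed_diff s_def)
  have "p i (E (zbar t'')) - a * p i (E u) - (1 - a) * p i (E (zbar t'))
      \<le> g t' \<bullet> (E (zbar t'') - a *\<^sub>R E u - (1 - a) *\<^sub>R E (zbar t'))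
        + L i / 2 * ((s * a)\<^sup>2 * (mnorm P (x - y))\<^sup>2) + \<delta> i"
    using up[unfolded dist_w] mult_left_mono[OF low1, of "1 - a"] mult_left_mono[OF low2, of a] a
    by (simp add: inner_simps algebra_simps)
  also have "\<dots> = s * (a * (g t' \<bullet> (x - u) + L i * scale t' / 2 * (mnorm P (x - y))\<^sup>2 + err i t'))"
    unfolding Ediff inner_scaleR_right using s a len_t by (simp add: s' err_def i_def field_simps power2_eq_square)
  \<comment> \<open>By the choice of the scale, the slope of \<open>embed t\<close> is divided out again.\<close>
  finally have "(p i (E (zbar t'')) - a * p i (E u) - (1 - a) * p i (E (zbar t'))) / s
      \<le> a * (g t' \<bullet> (x - u) + L i * scale t' / 2 * (mnorm P (x - y))\<^sup>2 + err i t')"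
    using s by (simp add: divide_le_eq mult.commute)
  moreover have "(p i (E (zbar t'')) - a * p i (E u) - (1 - a) * p i (E (zbar t'))) / s
      = (p i (E (zbar t'')) - p i (E u)) / s - (1 - a) * ((p i (E (zbar t')) - p i (E u)) / s)"
    using s by (simp add: field_simps)
  moreover have "Q i u \<bullet> (zbar t'' - u) = a * (Q i u \<bullet> (x - u)) + (1 - a) * (Q i u \<bullet> (zbar t' - u))"
    unfolding zbar_Suc[OF t k j] by (simp add: x_def a_def inner_simps algebra_simps)
  ultimately have "merit_term i t (zbar t'') u
      \<le> a * ((g t' \<bullet> (x - u) + Q i u \<bullet> (x - u)) + L i * scale t' / 2 * (mnorm P (x - y))\<^sup>2 + err i t')
        + (1 - a) * merit_term i t (zbar t') u"
    by (simp add: merit_term_def E_def s_def algebra_simps)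
  also have "\<dots> \<le> a * (prox_term t' x u + \<eta> t' / 2 * ((mnorm P (u - z t'))\<^sup>2 - (mnorm P (u - z t''))\<^sup>2)
        + err i t') + (1 - a) * merit_term i t (zbar t') u"
    using extragradient_step a by (intro add_right_mono mult_left_mono) (auto simp: x_def y_def i_def)
  also have "\<eta> t' / 2 * ((mnorm P (u - z t'))\<^sup>2 - (mnorm P (u - z t''))\<^sup>2)
      = rate i t' * (dist2 i t' u - dist2 i t'' u)"
    using len_t zero_pad_length[of t'] zero_pad_length[of t'']
    by (simp add: rate_def step_size_eq dist2_def i_def)
  finally show ?thesis by (simp add: i_def a_def x_def algebra_simps)
qed

text \<open>
  For deeper levels the inner call already bounds the error of the function rescaled once more, with
  comparison point \<open>embed t' u\<close>. Convexity bounds its value by the average of those at \<open>u\<close> and at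
  the previous \<open>zbar\<close>.
\<close>

lemma merit_term_inner:
  assumes i: "i \<in> {Suc (Suc k)..n}"
  shows "merit_term i t (zbar t'') u
    \<le> \<alpha> j * merit_term i t' (Rec t') u + (1 - \<alpha> j) * merit_term i t (zbar t') u"
proof -
  define s a where "s = scale t" and "a = \<alpha> j"
  have s: "s > 0" and a: "a > 0" "a \<le> 1"
    using scale_pos alpha_j by (auto simp: s_def a_def)
  have "embed t' u = a *\<^sub>R embed t u + (1 - a) *\<^sub>R embed t (zbar t')"
    by (simp add: embed_snoc embed_affine a_def)
  then have "p i (embed t' u) \<le> a * p i (embed t u) + (1 - a) * p i (embed t (zbar t'))"
    using convex_onD[OF p_convex, of i "1 - a" "embed t u" "embed t (zbar t')"] i a
      embed_in[OF t _ u] embed_in[OF t _ in_Z(4)] k by simp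
  then have "(p i (embed t' (Rec t')) - p i (embed t u)) / s
      \<le> (p i (embed t' (Rec t')) - p i (embed t' u) + (1 - a) * (p i (embed t (zbar t')) - p i (embed t u))) / s"
    using s by (intro divide_right_mono) (auto simp: algebra_simps)
  moreover have "Q i u \<bullet> (zbar t'' - u)
      = a * (Q i u \<bullet> (Rec t' - u)) + (1 - a) * (Q i u \<bullet> (zbar t' - u))"
    unfolding zbar_Suc[OF t k j] by (simp add: a_def inner_simps algebra_simps)
  moreover have "a * ((p i (embed t' (Rec t')) - p i (embed t' u)) / (s * a))
      + (1 - a) * ((p i (embed t (zbar t')) - p i (embed t u)) / s)
    = (p i (embed t' (Rec t')) - p i (embed t' u) + (1 - a) * (p i (embed t (zbar t')) - p i (embed t u))) / s"
    using a by (simp add: add_divide_distrib)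
  ultimately show ?thesis
    unfolding merit_term_def embed_zbar scale_snoc s_def[symmetric] a_def[symmetric] distrib_left
    by linarith
qed

lemma gap_step:
  "gap t (zbar t'') u \<le> (1 - \<alpha> j) * gap t (zbar t') u
    + \<alpha> j * (gap t' (Rec t') u
        + (rate (Suc k) t' * (dist2 (Suc k) t' u - dist2 (Suc k) t'' u) + err (Suc k) t'))"
proof -
  define c where "c = rate (Suc k) t' * (dist2 (Suc k) t' u - dist2 (Suc k) t'' u) + err (Suc k) t'"
  have prox: "prox_term (take i t) (zbar t'') u
      \<le> \<alpha> j * prox_term (take i t) (Rec t') u + (1 - \<alpha> j) * prox_term (take i t) (zbar t') u"
    if "i \<in> {1..k}" for i
    unfolding zbar_Suc[OF t k j]
    using that k multi_indices_take[OF t, of i] alpha_j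
    by (intro prox_term_convex step_size_nonneg[of _ i]) auto
  have split: "{Suc k..n} = insert (Suc k) {Suc (Suc k)..n}" using k by auto
  have "gap t (zbar t'') u = (\<Sum>i = 1..k. prox_term (take i t) (zbar t'') u)
      + (merit_term (Suc k) t (zbar t'') u + (\<Sum>i = Suc (Suc k)..n. merit_term i t (zbar t'') u))"
    by (simp add: gap_def len_t split)
  also have "\<dots> \<le> (\<Sum>i = 1..k. \<alpha> j * prox_term (take i t) (Rec t') u + (1 - \<alpha> j) * prox_term (take i t) (zbar t') u)
      + ((\<alpha> j * (prox_term t' (Rec t') u + c) + (1 - \<alpha> j) * merit_term (Suc k) t (zbar t') u)
        + (\<Sum>i = Suc (Suc k)..n. \<alpha> j * merit_term i t' (Rec t') u + (1 - \<alpha> j) * merit_term i t (zbar t') u))"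
    unfolding c_def by (intro add_mono sum_mono prox merit_term_current merit_term_inner)
  also have "\<dots> = (1 - \<alpha> j) * gap t (zbar t') u + \<alpha> j * (gap t' (Rec t') u + c)"
    by (simp add: gap_def len_t split sum.distrib flip: sum_distrib_left) (simp add: algebra_simps)
  finally show ?thesis by (simp only: c_def)
qed

end

text \<open>
  Leaving a loop restores a coefficient independent of \<open>j\<close>, and this is why the squared distances
  telescope over the whole loop.
\<close>

lemma rate_snoc:
  assumes "length t = k" "i \<ge> Suc k"
  shows "(\<alpha> (T (Suc k) - 1))\<^sup>2 * (rate i (t @ [j]) / \<alpha> j) = rate i t"
proof -
  have split: "{Suc k..i} = insert (Suc k) {Suc (Suc k)..i}" using assms by auto
  show ?thesis
    using sliding_alpha_pos[of j] sliding_alpha_pos[of "T (Suc k) - 1"] assms(1)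
    by (simp add: rate_def split scale_snoc rel_scale_snoc field_simps power2_eq_square)
qed

lemma err_snoc:
  assumes "length t = k" "i \<ge> Suc k" "i \<in> {1..n}" "j < T (Suc k)"
  shows "(\<alpha> (T (Suc k) - 1))\<^sup>2 * (err i (t @ [j]) / \<alpha> j) \<le> err i t / T (Suc k)"
proof -
  have split: "{Suc k..i} = insert (Suc k) {Suc (Suc k)..i}" using assms by auto
  define c where "c = \<delta> i * (\<Prod>l = Suc (Suc k)..i. real (T l)) / scale t"
  have c: "c \<ge> 0" unfolding c_def using LM[OF assms(3)] scale_pos[of t]
    by (intro divide_nonneg_pos mult_nonneg_nonneg prod_nonneg) auto
  have "\<alpha> (T (Suc k) - 1) / \<alpha> j \<le> 1"
    using sliding_alpha_antimono[of j "T (Suc k) - 1"] sliding_alpha_pos[of j] assms(4) by simp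
  then have "(\<alpha> (T (Suc k) - 1) / \<alpha> j)\<^sup>2 \<le> 1"
    using sliding_alpha_pos by (intro power_le_one) (auto intro: less_imp_le)
  then have "c * (\<alpha> (T (Suc k) - 1) / \<alpha> j)\<^sup>2 \<le> c * 1"
    using c by (intro mult_left_mono)
  moreover have "(\<alpha> (T (Suc k) - 1))\<^sup>2 * (err i (t @ [j]) / \<alpha> j) = c * (\<alpha> (T (Suc k) - 1) / \<alpha> j)\<^sup>2"
    using assms(1) by (simp add: err_def c_def scale_snoc power_divide power2_eq_square mult_ac)
  moreover have "err i t / T (Suc k) = c"
    using assms by (simp add: err_def c_def split)
  ultimately show ?thesis by simp
qed

text \<open>
  Downward induction on the level. The warm start identifies the last iterate of a deeper level in
  pass \<open>j\<close> with its first iterate in pass \<open>j + 1\<close>, so the distances of all levels \<open>i > k\<close> telescope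
  simultaneously over the loop at level \<open>k + 1\<close>.
\<close>

lemma gap_bound:
  assumes "t \<in> multi_indices T k" "k \<le> n" "u \<in> Z"
  shows "gap t (Rec t) u
    \<le> (\<Sum>i = Suc k..n. rate i t * (dist2 i t u - dist2 i (t @ [T (Suc k)]) u) + err i t)"
  using assms(2,1)
proof (induction k arbitrary: t rule: inc_induct)
  case base
  have len: "length t = n" by (rule length_multi_indices[OF base.prems])
  \<comment> \<open>At the innermost level the three-point inequality says that the gap is nonpositive.\<close>
  from prox_three_point[OF P Z Rec_innermost[OF base.prems] assms(3)] len
  have "(\<Sum>i = 1..n. prox_term (take i t) (Rec t) u) \<le> 0"
    by (simp add: prox_term_def sum_subtractf)
  then show ?case by (simp add: gap_def len)
next
  case (step k)
  note t = step.prems and k = step.hyps(2)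
  have len: "length t = k" by (rule length_multi_indices[OF t])
  define m a where "m = T (Suc k)" and "a = \<alpha> (m - 1)"
  have m: "m \<ge> 1" using T[of "Suc k"] k by (simp add: m_def)
  define b where "b = (\<lambda>j. \<Sum>i = Suc k..n. rate i (t @ [j])
      * (dist2 i (t @ [j]) u - dist2 i (t @ [Suc j]) u) + err i (t @ [j]))"
  have rec: "gap t (zbar (t @ [Suc j])) u \<le> (1 - \<alpha> j) * gap t (zbar (t @ [j])) u + \<alpha> j * b j"
    if "j < m" for j
  proof -
    have j: "j < T (Suc k)" using that by (simp add: m_def)
    have split: "{Suc k..n} = insert (Suc k) {Suc (Suc k)..n}" using k by auto
    have warm: "dist2 i ((t @ [j]) @ [T (Suc (Suc k))]) u = dist2 i (t @ [Suc j]) u"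
      if "i \<in> {Suc (Suc k)..n}" for i
      using z_warm_start[OF t k j that] by (simp add: dist2_def)
    have "gap (t @ [j]) (Rec (t @ [j])) u
        \<le> (\<Sum>i = Suc (Suc k)..n. rate i (t @ [j])
            * (dist2 i (t @ [j]) u - dist2 i (t @ [Suc j]) u) + err i (t @ [j]))"
      using step.IH[OF multi_indices_snoc[OF t j]] warm by simp
    then have "gap (t @ [j]) (Rec (t @ [j])) u
        + (rate (Suc k) (t @ [j]) * (dist2 (Suc k) (t @ [j]) u - dist2 (Suc k) (t @ [Suc j]) u)
          + err (Suc k) (t @ [j])) \<le> b j"
      by (simp add: b_def split)
    from mult_left_mono[OF this, of "\<alpha> j"] show ?thesis
      using gap_step[OF t k j assms(3)] sliding_alpha_pos[of j] by linarith
  qed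
  have "gap t (Rec t) u = gap t (zbar (t @ [m])) u"
    by (simp add: Rec_eq[OF t k] m_def)
  also have "\<dots> \<le> a\<^sup>2 * (\<Sum>j<m. b j / \<alpha> j)"
    unfolding a_def using weighted_recursion[OF m, of "\<lambda>j. gap t (zbar (t @ [j])) u" b] rec by simp
  also have "\<dots> = (\<Sum>i = Suc k..n. \<Sum>j<m. a\<^sup>2 * (rate i (t @ [j]) / \<alpha> j)
        * (dist2 i (t @ [j]) u - dist2 i (t @ [Suc j]) u) + a\<^sup>2 * (err i (t @ [j]) / \<alpha> j))"
    unfolding b_def sum_distrib_left sum_divide_distrib
    by (subst sum.swap)
      (intro sum.cong refl, simp add: algebra_simps add_divide_distrib diff_divide_distrib)
  also have "\<dots> \<le> (\<Sum>i = Suc k..n. rate i t * (dist2 i t u - dist2 i (t @ [m]) u) + err i t)"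
  proof (rule sum_mono)
    fix i assume i: "i \<in> {Suc k..n}"
    have "(\<Sum>j<m. a\<^sup>2 * (rate i (t @ [j]) / \<alpha> j)
        * (dist2 i (t @ [j]) u - dist2 i (t @ [Suc j]) u) + a\<^sup>2 * (err i (t @ [j]) / \<alpha> j))
      \<le> (\<Sum>j<m. rate i t * (dist2 i (t @ [j]) u - dist2 i (t @ [Suc j]) u) + err i t / m)"
      using rate_snoc[OF len, of i] err_snoc[OF len, of i] i
      by (intro sum_mono add_mono) (auto simp: a_def m_def)
    also have "\<dots> = rate i t * (dist2 i (t @ [0]) u - dist2 i (t @ [m]) u) + err i t"
      using m sum_lessThan_telescope'[of "\<lambda>j. dist2 i (t @ [j]) u" m]
      by (simp add: sum.distrib flip: sum_distrib_left)
    also have "dist2 i (t @ [0]) u = dist2 i t u"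
      using i len by (simp add: dist2_def zero_pad_snoc_0)
    finally show "(\<Sum>j<m. a\<^sup>2 * (rate i (t @ [j]) / \<alpha> j)
        * (dist2 i (t @ [j]) u - dist2 i (t @ [Suc j]) u) + a\<^sup>2 * (err i (t @ [j]) / \<alpha> j))
      \<le> rate i t * (dist2 i t u - dist2 i (t @ [m]) u) + err i t" .
  qed
  finally show ?case by (simp only: m_def)
qed

lemma output_gap_bound:
  assumes u: "u \<in> Z"
  shows "(\<Sum>i = 1..n. p i (Rec []) - p i u + Q i u \<bullet> (Rec [] - u))
    \<le> (\<Sum>i = 1..n. 2 ^ (2 * i - 1) * L i * (mnorm P (zin - u))\<^sup>2 / (N_prod T i)\<^sup>2
          + N_prod T i * \<delta> i + 2 ^ (i - 1) * M i * (mnorm P (zin - u))\<^sup>2 / N_prod T i)"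
proof -
  define \<Delta> where "\<Delta> = (mnorm P (zin - u))\<^sup>2"
  have "(\<Sum>i = 1..n. p i (Rec []) - p i u + Q i u \<bullet> (Rec [] - u)) = gap [] (Rec []) u"
    by (simp add: gap_def merit_term_def scale_def)
  also have "\<dots> \<le> (\<Sum>i = 1..n. rate i [] * (dist2 i [] u - dist2 i [T 1] u) + err i [])"
    using gap_bound[of "[]" 0 u] u by (simp add: multi_indices_def)
  also have "\<dots> \<le> (\<Sum>i = 1..n. 2 ^ (2 * i - 1) * L i * \<Delta> / (N_prod T i)\<^sup>2
          + N_prod T i * \<delta> i + 2 ^ (i - 1) * M i * \<Delta> / N_prod T i)"
  proof (rule sum_mono)
    fix i assume i: "i \<in> {1..n}"
    define A where "A = (\<Prod>l = 1..i. \<alpha> (T l - 1))"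
    have A: "0 \<le> A" "A \<le> 2 ^ i / N_prod T i"
    proof -
      show "0 \<le> A" unfolding A_def by (intro prod_nonneg) (auto intro: less_imp_le sliding_alpha_pos)
      have "\<alpha> (T l - 1) \<le> 2 / real (T l)" if "l \<in> {1..i}" for l
        using sliding_alpha_upper[OF T[of l]] that i by simp
      then have "A \<le> (\<Prod>l = 1..i. 2 / real (T l))"
        unfolding A_def by (intro prod_mono conjI) (auto intro: less_imp_le[OF sliding_alpha_pos])
      then show "A \<le> 2 ^ i / N_prod T i" by (simp add: N_prod_def prod_dividef)
    qed
    have rate_eq: "rate i [] = (L i * A\<^sup>2 + M i * A) / 2"
      by (simp add: rate_def scale_def rel_scale_def A_def prod_power_distrib)
    have pow: "(2::real) ^ i = 2 * 2 ^ (i - 1)" "((2::real) ^ i)\<^sup>2 = 2 * 2 ^ (2 * i - 1)"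
      using i by (simp_all flip: power_Suc power_mult add: mult.commute)
    have "rate i [] \<le> (L i * (2 ^ i / N_prod T i)\<^sup>2 + M i * (2 ^ i / N_prod T i)) / 2"
      unfolding rate_eq using A LM[OF i]
      by (intro divide_right_mono add_mono mult_left_mono power_mono) auto
    also have "\<dots> = 2 ^ (2 * i - 1) * L i / (N_prod T i)\<^sup>2 + 2 ^ (i - 1) * M i / N_prod T i"
      unfolding power_divide pow(2) unfolding pow(1) by (simp add: field_simps)
    finally have r: "rate i [] \<le> 2 ^ (2 * i - 1) * L i / (N_prod T i)\<^sup>2 + 2 ^ (i - 1) * M i / N_prod T i" .
    have "rate i [] \<ge> 0" unfolding rate_eq using A LM[OF i] by simp
    moreover have "dist2 i [] u = \<Delta>" "dist2 i [T 1] u \<ge> 0"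
      using z_start[OF i] by (simp_all add: dist2_def \<Delta>_def mnorm_minus_commute)
    ultimately have "rate i [] * (dist2 i [] u - dist2 i [T 1] u) \<le> rate i [] * \<Delta>"
      by (intro mult_left_mono) auto
    also have "\<dots> \<le> (2 ^ (2 * i - 1) * L i / (N_prod T i)\<^sup>2 + 2 ^ (i - 1) * M i / N_prod T i) * \<Delta>"
      using r by (intro mult_right_mono) (auto simp: \<Delta>_def)
    finally have "rate i [] * (dist2 i [] u - dist2 i [T 1] u)
        \<le> 2 ^ (2 * i - 1) * L i * \<Delta> / (N_prod T i)\<^sup>2 + 2 ^ (i - 1) * M i * \<Delta> / N_prod T i"
      by (simp add: distrib_right)
    moreover have "err i [] = N_prod T i * \<delta> i"
      by (simp add: err_def scale_def N_prod_def)
    ultimately show "rate i [] * (dist2 i [] u - dist2 i [T 1] u) + err i []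
        \<le> 2 ^ (2 * i - 1) * L i * \<Delta> / (N_prod T i)\<^sup>2
          + N_prod T i * \<delta> i + 2 ^ (i - 1) * M i * \<Delta> / N_prod T i"
      by linarith
  qed
  finally show ?thesis by (simp only: \<Delta>_def)
qed

end

section \<open>The rate of the sliding algorithm\<close>

theorem theorem3p5:
  fixes P :: "real^'d^'d"
    and Z :: "(real^'d) set"
    and X :: "nat \<Rightarrow> (real^'d) set"
    and p :: "nat \<Rightarrow> real^'d \<Rightarrow> real"
    and Q :: "nat \<Rightarrow> real^'d \<Rightarrow> real^'d"
    and n :: nat
    and M H \<nu> L :: "nat \<Rightarrow> real"
    and T :: "nat \<Rightarrow> nat"
    and \<Omega> :: real
    and N :: "nat \<Rightarrow> real"
    and zin zout :: "real^'d"
    and g z zbar ztil Rec :: "nat list \<Rightarrow> real^'d"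
  assumes n: "n \<ge> 1"
    and P: "sym_pos_def P"
    and Z: "Z \<noteq> {}" "closed Z" "convex Z"
    and Z_sub: "\<And>i. i \<in> {1..n} \<Longrightarrow> Z \<subseteq> X i"
    and p_convex: "\<And>i. i \<in> {1..n} \<Longrightarrow> convex_on (X i) (p i)"
    and p_subdiff: "\<And>i u. i \<in> {1..n} \<Longrightarrow> u \<in> Z \<Longrightarrow> subdifferential (X i) (p i) u \<noteq> {}"
    and Q_cont: "\<And>i. i \<in> {1..n} \<Longrightarrow> continuous_on Z (Q i)"
    and MH: "\<And>i. i \<in> {1..n} \<Longrightarrow> M i \<ge> 0 \<and> H i \<ge> 0 \<and> M i + H i > 0"
    and nu: "\<And>i. i \<in> {1..n} \<Longrightarrow> 0 \<le> \<nu> i \<and> \<nu> i \<le> 1"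
    and Q_mono: "\<And>i. i \<in> {1..n} \<Longrightarrow> monotone_operator Z (Q i)"
    and Q_lip: "\<And>i. i \<in> {1..n} \<Longrightarrow> lipschitz_operator P Z (M i) (Q i)"
    and p_holder: "\<And>i. i \<in> {1..n} \<Longrightarrow> holder_condition P (X i) Z (\<nu> i) (H i) (p i)"
    and T: "\<And>i. i \<in> {1..n} \<Longrightarrow> T i \<ge> 1"
    and zin: "zin \<in> Z"
    and Omega_finite: "bdd_above ((\<lambda>z. (mnorm P (zin - z))\<^sup>2) ` Z)"
    and Omega: "\<Omega> = Omega P Z zin"
    and N: "\<And>i. i \<in> {1..n} \<Longrightarrow> N i = N_prod T i"
    and L: "\<And>i. i \<in> {1..n} \<Longrightarrow> L i = L_const (\<nu> i) (H i) (delta_opt (\<nu> i) (H i) \<Omega> i (N i))"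
    and run: "sliding_run P Z n Q T sliding_alpha (sliding_step L M T) zin g z zbar ztil Rec"
    and exact: "\<And>i t. i \<in> {1..n} \<Longrightarrow> t \<in> multi_indices T i \<Longrightarrow>
                  g t \<in> subdifferential (X i) (p i) (query_point sliding_alpha z zbar t)"
    and zout: "zout = Rec []"
  shows "(SUP u\<in>Z. ereal ((\<Sum>i = 1..n. p i zout) - (\<Sum>i = 1..n. p i u)
                          + (\<Sum>i = 1..n. Q i u) \<bullet> (zout - u)))
         \<le> ereal (\<Sum>i = 1..n.
               2 powr (real i * (1 + \<nu> i)) * H i * \<Omega> powr ((1 + \<nu> i) / 2)
                 / ((1 + \<nu> i) * N i powr ((1 + 3 * \<nu> i) / 2))
               + 2 ^ (i - 1) * M i * \<Omega> / N i)"
proof -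
  define \<delta> where "\<delta> = (\<lambda>i. delta_opt (\<nu> i) (H i) \<Omega> i (N i))"
  have diam: "(mnorm P (zin - u))\<^sup>2 \<le> \<Omega>" if "u \<in> Z" for u
    unfolding Omega Omega_def using that Omega_finite by (rule cSUP_upper)
  have \<Omega>: "\<Omega> \<ge> 0" using diam[OF zin] by simp
  have Npos: "N i > 0" if "i \<in> {1..n}" for i
    unfolding N[OF that] N_prod_def using T that by (intro prod_pos) force
  have L_eq: "L i = L_const (\<nu> i) (H i) (\<delta> i)" if "i \<in> {1..n}" for i
    using L[OF that] by (simp add: \<delta>_def)
  have LM: "L i \<ge> 0 \<and> M i \<ge> 0 \<and> \<delta> i \<ge> 0" if "i \<in> {1..n}" for i
    using MH[OF that] by (simp add: L_eq[OF that] L_const_def \<delta>_def delta_opt_def)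
  have descent: "p i y \<le> p i w + s \<bullet> (y - w) + L i / 2 * (mnorm P (y - w))\<^sup>2 + \<delta> i"
    if i: "i \<in> {1..n}" and y: "y \<in> Z" and w: "w \<in> Z" and s: "s \<in> subdifferential (X i) (p i) w"
    for i y w s
  proof -
    \<comment> \<open>If \<open>\<Omega> = 0\<close> then \<open>Z\<close> is a single point, so the value \<open>L = 0\<close> for \<open>\<nu> < 1\<close> is harmless.\<close>
    have "y = w" if "\<Omega> = 0"
    proof -
      have "zin - u = 0" if "u \<in> Z" for u
        using diam[OF that] mnorm_pos[OF P, of "zin - u"] \<open>\<Omega> = 0\<close> by fastforce
      from this[OF y] this[OF w] show ?thesis by simp
    qed
    then have "H i / (1 + \<nu> i) * mnorm P (y - w) powr (1 + \<nu> i)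
        \<le> L i / 2 * (mnorm P (y - w))\<^sup>2 + \<delta> i"
      unfolding L_eq[OF i] \<delta>_def using nu[OF i] MH[OF i] \<Omega> Npos[OF i] i mnorm_nonneg[OF P]
      by (intro holder_term_le_tuned_quadratic) auto
    moreover have "p i y \<le> p i w + s \<bullet> (y - w) + H i / (1 + \<nu> i) * mnorm P (y - w) powr (1 + \<nu> i)"
      using nu[OF i] MH[OF i] i y w s
      by (intro holder_upper_bound[OF P Z(3) Z_sub p_subdiff p_holder]) auto
    ultimately show ?thesis by simp
  qed
  interpret sliding_descent P Z n p Q T L M \<delta> zin g z zbar ztil Rec
  proof
    fix i t y assume it: "i \<in> {1..n}" "t \<in> multi_indices T i" and y: "y \<in> Z"
    note s = exact[OF it]
    show "p i (query_point sliding_alpha z zbar t)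
        + g t \<bullet> (y - query_point sliding_alpha z zbar t) \<le> p i y"
      using s y Z_sub[OF it(1)] by (auto simp: subdifferential_def)
    show "p i y \<le> p i (query_point sliding_alpha z zbar t)
        + g t \<bullet> (y - query_point sliding_alpha z zbar t)
        + L i / 2 * (mnorm P (y - query_point sliding_alpha z zbar t))\<^sup>2 + \<delta> i"
      if "query_point sliding_alpha z zbar t \<in> Z"
      using descent[OF it(1) y that s] .
  next
    show "convex_on Z (p i)" if "i \<in> {1..n}" for i
      using convex_on_subset[OF p_convex[OF that] Z_sub[OF that] Z(3)] .
  qed (use P Z zin run T LM Q_mono Q_lip in auto)
  show ?thesis
  proof (intro SUP_least, unfold ereal_less_eq)
    fix u assume u: "u \<in> Z"
    have "(\<Sum>i = 1..n. p i zout) - (\<Sum>i = 1..n. p i u) + (\<Sum>i = 1..n. Q i u) \<bullet> (zout - u)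
        = (\<Sum>i = 1..n. p i (Rec []) - p i u + Q i u \<bullet> (Rec [] - u))"
      by (simp add: zout sum.distrib sum_subtractf inner_sum_left)
    also have "\<dots> \<le> (\<Sum>i = 1..n. 2 ^ (2 * i - 1) * L i * (mnorm P (zin - u))\<^sup>2 / (N_prod T i)\<^sup>2
          + N_prod T i * \<delta> i + 2 ^ (i - 1) * M i * (mnorm P (zin - u))\<^sup>2 / N_prod T i)"
      by (rule output_gap_bound[OF u])
    also have "\<dots> \<le> (\<Sum>i = 1..n. 2 ^ (2 * i - 1) * L i * \<Omega> / (N i)\<^sup>2 + N i * \<delta> i
          + 2 ^ (i - 1) * M i * \<Omega> / N i)"
    proof (rule sum_mono)
      fix i assume i: "i \<in> {1..n}"
      show "2 ^ (2 * i - 1) * L i * (mnorm P (zin - u))\<^sup>2 / (N_prod T i)\<^sup>2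
          + N_prod T i * \<delta> i + 2 ^ (i - 1) * M i * (mnorm P (zin - u))\<^sup>2 / N_prod T i
        \<le> 2 ^ (2 * i - 1) * L i * \<Omega> / (N i)\<^sup>2 + N i * \<delta> i + 2 ^ (i - 1) * M i * \<Omega> / N i"
        unfolding N[OF i, symmetric] using LM[OF i] Npos[OF i] diam[OF u]
        by (intro add_mono divide_right_mono mult_left_mono) auto
    qed
    also have "\<dots> = (\<Sum>i = 1..n. 2 powr (real i * (1 + \<nu> i)) * H i * \<Omega> powr ((1 + \<nu> i) / 2)
          / ((1 + \<nu> i) * N i powr ((1 + 3 * \<nu> i) / 2)) + 2 ^ (i - 1) * M i * \<Omega> / N i)"
    proof (rule sum.cong)
      fix i assume i: "i \<in> {1..n}"
      show "2 ^ (2 * i - 1) * L i * \<Omega> / (N i)\<^sup>2 + N i * \<delta> i + 2 ^ (i - 1) * M i * \<Omega> / N i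
        = 2 powr (real i * (1 + \<nu> i)) * H i * \<Omega> powr ((1 + \<nu> i) / 2)
          / ((1 + \<nu> i) * N i powr ((1 + 3 * \<nu> i) / 2)) + 2 ^ (i - 1) * M i * \<Omega> / N i"
        using tuned_bound_value[of "\<nu> i" "H i" \<Omega> "N i" i] nu[OF i] MH[OF i] \<Omega> Npos[OF i] i
        by (simp add: L_eq[OF i] \<delta>_def)
    qed simp
    finally show "(\<Sum>i = 1..n. p i zout) - (\<Sum>i = 1..n. p i u) + (\<Sum>i = 1..n. Q i u) \<bullet> (zout - u)
      \<le> (\<Sum>i = 1..n. 2 powr (real i * (1 + \<nu> i)) * H i * \<Omega> powr ((1 + \<nu> i) / 2)
          / ((1 + \<nu> i) * N i powr ((1 + 3 * \<nu> i) / 2)) + 2 ^ (i - 1) * M i * \<Omega> / N i)" .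
  qed
qed

end
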